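(* Let $\theta\in(0,1)$ be irrational with $w(\theta)=1$. Then $\mathcal U_\tau[\theta]=\mathbb T$ if $0<\tau<1$, $\mathcal U_\tau[\theta]=\{i\theta: i\ge1\}$ if $\tau>1$, and $\tfrac12\le\dim_H\mathcal U_1[\theta]\le1$.
   Context: $\mathbb T=\mathbb R/\mathbb Z$; points identified with fractional parts. $\|t\|$ is the distance from $t$ to the nearest integer. For irrational $\theta$, $w(\theta)=\sup\{s>0:\liminf_{j\to\infty}j^s\|j\theta\|=0\}$. For $\tau>0$, $\mathcal U_\tau[\theta]$ is the set of $y\in\mathbb T$ such that there exists $Q_0$ with: for every real $Q\ge Q_0$ there is an integer $1\le n\le Q$ with $\|n\theta-y\|<Q^{-\tau}$. *)

theory Defs
  imports "HOL-Analysis.Analysis"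
begin

text \<open>The torus T = R/Z is identified with the set of fractional parts [0,1).\<close>
definition torus :: "real set" where
  "torus = {0..<1}"

definition dist_int :: "real \<Rightarrow> real" where
  "dist_int t = \<bar>t - of_int (round t)\<bar>"

definition irr_exp :: "real \<Rightarrow> ereal" where
  "irr_exp \<theta> = Sup (ereal ` {s. s > 0 \<and>
      Liminf sequentially (\<lambda>j::nat. ereal (real j powr s * dist_int (real j * \<theta>))) = 0})"

definition unif_approx :: "real \<Rightarrow> real \<Rightarrow> real set" where
  "unif_approx \<tau> \<theta> = {y \<in> torus. \<exists>Q0::real. \<forall>Q::real. Q \<ge> Q0 \<longrightarrow>
      (\<exists>n::nat. 1 \<le> n \<and> real n \<le> Q \<and> dist_int (real n * \<theta> - y) < Q powr (- \<tau>))}"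

text \<open>Hausdorff outer measure and Hausdorff dimension of subsets of the real line,
  via countable delta-covers by bounded sets (with the convention diam^0 = 1 for
  nonempty sets and empty sets contributing 0).\<close>
definition hs_weight :: "real \<Rightarrow> real set \<Rightarrow> ennreal" where
  "hs_weight s U = (if U = {} then 0 else if s = 0 then 1 else ennreal (diameter U powr s))"

definition hausdorff_content_delta :: "real \<Rightarrow> real \<Rightarrow> real set \<Rightarrow> ennreal" where
  "hausdorff_content_delta s \<delta> E =
     (INF U \<in> {U :: nat \<Rightarrow> real set. E \<subseteq> (\<Union>i. U i) \<and>
                (\<forall>i. bounded (U i) \<and> diameter (U i) \<le> \<delta>)}.
        (\<Sum>i. hs_weight s (U i)))"

definition hausdorff_outer :: "real \<Rightarrow> real set \<Rightarrow> ennreal" where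
  "hausdorff_outer s E = (SUP \<delta> \<in> {0<..}. hausdorff_content_delta s \<delta> E)"

definition hausdorff_dim :: "real set \<Rightarrow> real" where
  "hausdorff_dim E = Inf {s. s \<ge> 0 \<and> hausdorff_outer s E = 0}"

end

theory Submission
  imports Defs "HOL-Library.Discrete_Functions"
begin

text \<open>
  Since w = 1, for every s > 1 there is c > 0 with ||j theta|| >= c j^(-s) for all j >= 1.

  For tau < 1, Dirichlet's theorem gives a fraction h/q with q <= Q and |q theta - h| < 1/Q; the
  lower bound forces q to be nearly as large as Q, and the points n theta with n <= q are
  2/q-dense. For tau > 1, the approximants n(N) chosen for Q = N and Q = N + 1 would, if distinct,
  give ||(n(N+1) - n(N)) theta|| < 2 N^(-tau), contradicting the lower bound; so n(N) is
  eventually constant.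

  For tau = 1, expand y in the Ostrowski numeration system of theta, that is, as a sum of terms
  m_k (q_k theta - p_k). If every digit satisfies m_k^2 <= c_k, where c_k is the largest digit
  admissible after the preceding ones, then y is in the set. The cells
  of this Cantor set satisfy the inequality sqrt |parent| <= sum of sqrt |child|, so that it carries
  a mass distribution giving each cell mass at most the square root of its length. The lower
  bound on ||j theta|| makes the lengths of successive cells comparable up to an exponent
  arbitrarily close to 1, whence dimension at least 1/2.
\<close>

section \<open>Cantor sets with square-root mass\<close>

text \<open>
  The mass distribution is encoded by an inverse of its distribution function: each cell of level
  k carries a subinterval of \<open>[0, width)\<close>, stored as (left end, length) in \<open>path\<close>, of length at most
  the square root of the length of the cell, and \<open>point\<close> follows these intervals. Because
  |t - t'| is bounded by a power of |point t - point t'|, a cover of the Cantor set pulls back to a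
  cover of \<open>[0, width)\<close>, and no limit measure is needed.
\<close>

locale interval_tree =
  fixes lo hi :: "nat \<Rightarrow> 'c \<Rightarrow> real" and arity :: "nat \<Rightarrow> 'c \<Rightarrow> nat"
    and child :: "nat \<Rightarrow> 'c \<Rightarrow> nat \<Rightarrow> 'c" and root :: 'c and L :: "nat \<Rightarrow> real"
  assumes L_pos: "0 < L k"
    and L_le: "L k \<le> hi k c - lo k c"
    and le_L: "hi k c - lo k c \<le> 2 * L k"
    and L_lim: "L \<longlonglongrightarrow> 0"
    and child_lo: "i < arity k c \<Longrightarrow> lo k c \<le> lo (Suc k) (child k c i)"
    and child_hi: "i < arity k c \<Longrightarrow> hi (Suc k) (child k c i) \<le> hi k c"
    and child_order: "i < j \<Longrightarrow> j < arity k c \<Longrightarrow>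
      hi (Suc k) (child k c i) \<le> lo (Suc k) (child k c j)"
    and sqrt_le: "sqrt (hi k c - lo k c) \<le>
      (\<Sum>i<arity k c. sqrt (hi (Suc k) (child k c i) - lo (Suc k) (child k c i)))"
begin

section \<open>Mass intervals of the cells\<close>

definition cum :: "nat \<Rightarrow> 'c \<Rightarrow> nat \<Rightarrow> real" where
  "cum k c i = (\<Sum>j<i. sqrt (hi (Suc k) (child k c j) - lo (Suc k) (child k c j)))"

text \<open>The children share a mass interval of length \<open>w\<close> in proportion to the
  square roots of their lengths. By \<open>sqrt_le\<close> this factor is at most 1 whenever
  \<open>w\<close> is at most the square root of the parent's length, so that bound passes to the
  children.\<close>

definition scale :: "nat \<Rightarrow> 'c \<Rightarrow> real \<Rightarrow> real" where
  "scale k c w = w / cum k c (arity k c)"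

definition index :: "nat \<Rightarrow> real \<Rightarrow> 'c \<times> real \<times> real \<Rightarrow> nat" where
  "index k t = (\<lambda>(c, u, w). LEAST j. t < u + scale k c w * cum k c (Suc j))"

fun path :: "real \<Rightarrow> nat \<Rightarrow> 'c \<times> real \<times> real" where
  "path t 0 = (root, 0, sqrt (hi 0 root - lo 0 root))"
| "path t (Suc k) = (case path t k of (c, u, w) \<Rightarrow>
     let i = index k t (c, u, w) in
       (child k c i, u + scale k c w * cum k c i,
        scale k c w * (cum k c (Suc i) - cum k c i)))"

lemma cum_Suc: "cum k c (Suc i) - cum k c i =
    sqrt (hi (Suc k) (child k c i) - lo (Suc k) (child k c i))"
  by (simp add: cum_def)

lemma len_pos: "0 < hi k c - lo k c"
  using L_pos[of k] L_le[of k c] by linarith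

lemma cum_strict_mono: "strict_mono (cum k c)"
proof -
  have "0 < cum k c (Suc i) - cum k c i" for i
    unfolding cum_Suc using len_pos by (rule real_sqrt_gt_zero)
  thus ?thesis by (simp add: strict_mono_Suc_iff)
qed

lemma sqrt_le_cum: "sqrt (hi k c - lo k c) \<le> cum k c (arity k c)"
  using sqrt_le by (simp add: cum_def)

lemma cum_arity_pos: "0 < cum k c (arity k c)"
  using sqrt_le_cum[of k c] len_pos[of k c] by (meson less_le_trans real_sqrt_gt_zero)

text \<open>The scaled intervals of the children fill [u, u + w), so the last child is a candidate
  for the least index; minimality then supplies the left end.\<close>

lemma index_props:
  fixes k c t u w
  assumes "u \<le> t" "t < u + w" "0 < w"
  defines "i \<equiv> index k t (c, u, w)"
  shows "i < arity k c" "u + scale k c w * cum k c i \<le> t" "t < u + scale k c w * cum k c (Suc i)"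
proof -
  have sw: "scale k c w * cum k c (arity k c) = w" "0 < scale k c w"
    using cum_arity_pos[of k c] assms by (auto simp: scale_def)
  have "cum k c 0 = 0" by (simp add: cum_def)
  hence "arity k c \<noteq> 0" using cum_arity_pos[of k c] by (intro notI) simp
  then obtain N where N: "arity k c = Suc N"
    using not0_implies_Suc by blast
  have P: "t < u + scale k c w * cum k c (Suc N)"
    using sw N assms by simp
  show "t < u + scale k c w * cum k c (Suc i)"
    unfolding i_def index_def prod.case by (rule LeastI) (rule P)
  have "i \<le> N"
    unfolding i_def index_def prod.case by (rule Least_le) (rule P)
  thus "i < arity k c" using N by simp
  show "u + scale k c w * cum k c i \<le> t"
  proof (cases i)
    case 0
    thus ?thesis using assms(1) by (simp add: cum_def)
  next
    case (Suc m)
    hence "m < i" by simp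
    hence "\<not> t < u + scale k c w * cum k c (Suc m)"
      unfolding i_def index_def prod.case by (rule not_less_Least)
    thus ?thesis using Suc by simp
  qed
qed

definition width :: real where "width = sqrt (hi 0 root - lo 0 root)"

lemma width_pos: "0 < width"
  using len_pos by (simp add: width_def)

lemma path_inv:
  assumes "0 \<le> t" "t < width" "path t k = (c, u, w)"
  shows "u \<le> t \<and> t < u + w \<and> 0 < w \<and> w \<le> sqrt (hi k c - lo k c)"
  using assms(3)
proof (induction k arbitrary: c u w)
  case 0
  hence "(root, 0, width) = (c, u, w)" unfolding width_def path.simps .
  hence "c = root" "u = 0" "w = width" by auto
  thus ?case using assms(1,2) width_pos by (simp add: width_def[symmetric])
next
  case (Suc k)
  obtain c0 u0 w0 where p: "path t k = (c0, u0, w0)" by (cases "path t k") auto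
  note IH = Suc.IH[OF p]
  define i where "i = index k t (c0, u0, w0)"
  have e: "c = child k c0 i" "u = u0 + scale k c0 w0 * cum k c0 i"
    "w = scale k c0 w0 * (cum k c0 (Suc i) - cum k c0 i)"
    using Suc.prems p by (auto simp: Let_def i_def)
  have ip: "i < arity k c0" "u \<le> t" "t < u0 + scale k c0 w0 * cum k c0 (Suc i)"
    using index_props[of u0 t w0 k c0] IH e i_def by auto
  have s: "0 < scale k c0 w0" using IH cum_arity_pos[of k c0] by (simp add: scale_def)
  have s1: "scale k c0 w0 \<le> 1"
    using IH sqrt_le_cum[of k c0] cum_arity_pos[of k c0] by (simp add: scale_def divide_le_eq)
  have "w = scale k c0 w0 * sqrt (hi (Suc k) c - lo (Suc k) c)"
    using e cum_Suc by simp
  moreover have sp: "0 < sqrt (hi (Suc k) c - lo (Suc k) c)" using len_pos by simp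
  ultimately have "0 < w" "w \<le> sqrt (hi (Suc k) c - lo (Suc k) c)"
    using s s1 by (auto simp: mult_le_cancel_right2)
  moreover have "t < u + w" using ip e by (simp add: algebra_simps)
  ultimately show ?case using ip by simp
qed

definition cell :: "real \<Rightarrow> nat \<Rightarrow> 'c" where "cell t k = fst (path t k)"

lemma cell_0: "cell t 0 = root"
  by (simp add: cell_def)

lemma cell_Suc:
  assumes "0 \<le> t" "t < width"
  shows "\<exists>i < arity k (cell t k). cell t (Suc k) = child k (cell t k) i"
proof -
  obtain c u w where p: "path t k = (c, u, w)" by (cases "path t k") auto
  show ?thesis
    using p path_inv[OF assms p] index_props(1)[of u t w k c]
    by (auto simp: cell_def Let_def)
qed

text \<open>Mass intervals and cells are ordered alike. Paths with a common parent are compared by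
  child index, where a reversed order would contradict t \<le> t'; once separated, they stay so by
  nesting.\<close>

lemma path_order:
  assumes "0 \<le> t" "t \<le> t'" "t' < width" "path t k = (c, u, w)" "path t' k = (c', u', w')"
  shows "(c, u, w) = (c', u', w') \<or> (u + w \<le> u' \<and> hi k c \<le> lo k c')"
  using assms(4,5)
proof (induction k arbitrary: c u w c' u' w')
  case 0
  thus ?case by (metis path.simps(1))
next
  case (Suc k)
  obtain c0 u0 w0 where p: "path t k = (c0, u0, w0)" by (cases "path t k") auto
  obtain c1 u1 w1 where p': "path t' k = (c1, u1, w1)" by (cases "path t' k") auto
  note IH = Suc.IH[OF p p']
  have t: "0 \<le> t" "t < width" "0 \<le> t'" "t' < width" using assms by auto
  note inv = path_inv[OF t(1,2) p]
  note inv' = path_inv[OF t(3,4) p']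
  define i where "i = index k t (c0, u0, w0)"
  define i' where "i' = index k t' (c1, u1, w1)"
  have e: "c = child k c0 i" "u = u0 + scale k c0 w0 * cum k c0 i"
    "w = scale k c0 w0 * (cum k c0 (Suc i) - cum k c0 i)"
    using Suc.prems p by (auto simp: Let_def i_def)
  have e': "c' = child k c1 i'" "u' = u1 + scale k c1 w1 * cum k c1 i'"
    "w' = scale k c1 w1 * (cum k c1 (Suc i') - cum k c1 i')"
    using Suc.prems p' by (auto simp: Let_def i'_def)
  have ip: "i < arity k c0" "u \<le> t" "t < u0 + scale k c0 w0 * cum k c0 (Suc i)"
    using index_props[of u0 t w0 k c0] inv e i_def by auto
  have ip': "i' < arity k c1" "u' \<le> t'" "t' < u1 + scale k c1 w1 * cum k c1 (Suc i')"
    using index_props[of u1 t' w1 k c1] inv' e' i'_def by auto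
  have s: "0 < scale k c0 w0" using inv cum_arity_pos[of k c0] by (simp add: scale_def)
  have s': "0 < scale k c1 w1" using inv' cum_arity_pos[of k c1] by (simp add: scale_def)
  from IH show ?case
  proof
    assume eq: "(c0, u0, w0) = (c1, u1, w1)"
    consider "i = i'" | "i < i'" | "i' < i" by linarith
    then show ?case
    proof cases
      case 1
      thus ?thesis using e e' eq by auto
    next
      case 2
      hence "cum k c0 (Suc i) \<le> cum k c0 i'"
        using cum_strict_mono[of k c0] by (simp add: strict_mono_less_eq)
      hence "u + w \<le> u'"
        using e e' eq s by (auto simp: algebra_simps)
      thus ?thesis using child_order[OF 2, of k c0] ip' e e' eq by auto
    next
      case 3
      hence "cum k c0 (Suc i') \<le> cum k c0 i"
        using cum_strict_mono[of k c0] by (simp add: strict_mono_less_eq)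
      hence "scale k c0 w0 * cum k c0 (Suc i') \<le> scale k c0 w0 * cum k c0 i"
        using s by simp
      hence "t' < t" using ip ip' e e' eq by auto
      thus ?thesis using assms by simp
    qed
  next
    assume o: "u0 + w0 \<le> u1 \<and> hi k c0 \<le> lo k c1"
    have "cum k c0 (Suc i) \<le> cum k c0 (arity k c0)"
      using cum_strict_mono[of k c0] ip by (simp add: strict_mono_less_eq)
    hence "scale k c0 w0 * cum k c0 (Suc i) \<le> scale k c0 w0 * cum k c0 (arity k c0)"
      using s by simp
    also have "\<dots> = w0" using cum_arity_pos[of k c0] by (simp add: scale_def)
    finally have 1: "u + w \<le> u0 + w0" using e by (simp add: algebra_simps)
    have "cum k c1 0 \<le> cum k c1 i'"
      using cum_strict_mono[of k c1] by (simp only: strict_mono_less_eq)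
    hence "0 \<le> cum k c1 i'" by (simp add: cum_def)
    hence "u1 \<le> u'" using e' s' by simp
    thus ?thesis using 1 o child_lo[OF ip'(1)] child_hi[OF ip(1)] e e' by auto
  qed
qed

section \<open>Limit points and the inverse Hoelder bound\<close>

definition point :: "real \<Rightarrow> real" where "point t = (SUP k. lo k (cell t k))"

lemma point_mem:
  assumes "0 \<le> t" "t < width"
  shows "lo k (cell t k) \<le> point t \<and> point t \<le> hi k (cell t k)"
proof -
  have "lo k (cell t k) \<le> lo (Suc k) (cell t (Suc k))" for k
    using cell_Suc[OF assms, of k] child_lo by metis
  hence inc: "incseq (\<lambda>k. lo k (cell t k))" by (simp add: incseq_Suc_iff)
  have "hi (Suc k) (cell t (Suc k)) \<le> hi k (cell t k)" for k
    using cell_Suc[OF assms, of k] child_hi by metis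
  hence dec: "decseq (\<lambda>k. hi k (cell t k))" by (simp add: decseq_Suc_iff)
  have le: "lo j (cell t j) \<le> hi k (cell t k)" for j k
  proof -
    have "lo j (cell t j) \<le> lo (max j k) (cell t (max j k))"
      using inc by (auto simp: incseq_def)
    also have "\<dots> \<le> hi (max j k) (cell t (max j k))"
      using len_pos[of "max j k" "cell t (max j k)"] by simp
    also have "\<dots> \<le> hi k (cell t k)" using dec by (auto simp: decseq_def)
    finally show ?thesis .
  qed
  show ?thesis unfolding point_def
    by (intro conjI cSUP_least cSUP_upper bdd_aboveI2[of _ _ "hi 0 (cell t 0)"]) (use le in auto)
qed

text \<open>If the parameters were further apart, their midpoint would lie more than
  \<open>sqrt (2 * L k)\<close>, the maximal length of a mass interval of level k, from both. Then
  the whole cell of the midpoint, of length at least \<open>L k\<close>, would separate the two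
  points.\<close>

lemma close_points:
  assumes "0 \<le> t" "t \<le> t'" "t' < width" "\<bar>point t - point t'\<bar> < L k"
  shows "t' - t \<le> sqrt (8 * L k)"
proof (rule ccontr)
  assume *: "\<not> ?thesis"
  define m where "m = (t + t') / 2"
  have "sqrt (8 * L k) = 2 * sqrt (2 * L k)"
    using real_sqrt_mult[of 4 "2 * L k"] by simp
  hence far: "t + sqrt (2 * L k) < m" "m + sqrt (2 * L k) < t'"
    using * by (auto simp: m_def field_simps)
  have Lk: "0 < sqrt (2 * L k)" using L_pos[of k] by simp
  obtain c u w where p: "path t k = (c, u, w)" by (cases "path t k") auto
  obtain c' u' w' where p': "path t' k = (c', u', w')" by (cases "path t' k") auto
  obtain d v z where pm: "path m k = (d, v, z)" by (cases "path m k") auto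
  have m: "0 \<le> m" "m < width" "t \<le> m" "m \<le> t'" using assms by (auto simp: m_def)
  have i: "u \<le> t" "t < u + w" using path_inv[OF _ _ p] assms by auto
  have i': "u' \<le> t'" "t' < u' + w'" using path_inv[OF _ _ p'] assms by auto
  have im: "v \<le> m" "m < v + z" "z \<le> sqrt (hi k d - lo k d)" using path_inv[OF m(1,2) pm] by auto
  have "sqrt (hi k d - lo k d) \<le> sqrt (2 * L k)" using le_L by simp
  hence z: "z \<le> sqrt (2 * L k)" using im by linarith
  have "(c, u, w) \<noteq> (d, v, z)" "(d, v, z) \<noteq> (c', u', w')"
    using z i i' im far by auto
  hence "hi k c \<le> lo k d" "hi k d \<le> lo k c'"
    using path_order[OF assms(1) m(3,2) p pm] path_order[OF m(1,4) assms(3) pm p'] by auto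
  moreover have "point t \<le> hi k c" "lo k c' \<le> point t'"
    using point_mem[of t k] point_mem[of t' k] assms p p' by (auto simp: cell_def)
  ultimately show False using assms(4) L_le[of k d] by linarith
qed

lemma hoelder:
  assumes s: "0 < s" and D: "\<And>k. sqrt (L k) \<le> D * L (Suc k) powr s"
  shows "\<exists>C>0. \<forall>t t'. 0 \<le> t \<and> t \<le> t' \<and> t' < width \<longrightarrow>
    t' - t \<le> C * \<bar>point t - point t'\<bar> powr s"
proof -
  have "0 < sqrt (L 0)" using L_pos by simp
  hence "0 < D * L (Suc 0) powr s" using D[of 0] by linarith
  hence Dpos: "0 < D" by (simp add: zero_less_mult_iff)
  define C where "C = max (width / L 0 powr s) (sqrt 8 * D)"
  have "0 < C" using Dpos by (simp add: C_def less_max_iff_disj)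
  moreover have "t' - t \<le> C * \<bar>point t - point t'\<bar> powr s"
    if t: "0 \<le> t" "t \<le> t'" "t' < width" for t t'
  proof (cases "t = t'")
    case True
    thus ?thesis using \<open>0 < C\<close> by simp
  next
    case False
    define d where "d = \<bar>point t - point t'\<bar>"
    have close: "t' - t \<le> sqrt (8 * L k)" if "d < L k" for k
      using close_points[OF t] that by (simp add: d_def)
    have ex: "\<exists>k. L k \<le> d"
    proof (rule ccontr)
      assume "\<nexists>k. L k \<le> d"
      hence "t' - t \<le> sqrt (8 * L k)" for k using close by (simp add: not_le)
      moreover have "(\<lambda>k. sqrt (8 * L k)) \<longlonglongrightarrow> sqrt (8 * 0)"
        by (intro tendsto_intros L_lim)
      ultimately have "t' - t \<le> sqrt (8 * 0)"
        by (intro LIMSEQ_le_const) auto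
      thus False using False t by simp
    qed
    \<comment> \<open>At the level before j the distance is still below \<open>L\<close>, so
      \<open>close_points\<close> applies there, and \<open>D\<close> converts that scale into
      \<open>L j\<close>. For j = 0 the trivial bound by \<open>width\<close> suffices.\<close>
    define j where "j = (LEAST k. L k \<le> d)"
    have j: "L j \<le> d" unfolding j_def using ex by (rule LeastI_ex)
    have ps: "L j powr s \<le> d powr s" using j L_pos[of j] s by (intro powr_mono2) auto
    show ?thesis
    proof (cases j)
      case 0
      have "t' - t \<le> width" using t by simp
      also have "\<dots> = width / L 0 powr s * L 0 powr s" using L_pos[of 0] by simp
      also have "\<dots> \<le> C * d powr s"
        using ps 0 \<open>0 < C\<close> by (intro mult_mono) (auto simp: C_def)
      finally show ?thesis by (simp add: d_def)
    next
      case (Suc k)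
      hence "k < j" by simp
      hence "\<not> L k \<le> d" unfolding j_def by (rule not_less_Least)
      hence "t' - t \<le> sqrt (8 * L k)" using close by simp
      also have "\<dots> = sqrt 8 * sqrt (L k)" by (rule real_sqrt_mult)
      also have "\<dots> \<le> sqrt 8 * (D * L (Suc k) powr s)" using D by (intro mult_left_mono) auto
      also have "\<dots> = (sqrt 8 * D) * L j powr s" using Suc by simp
      also have "\<dots> \<le> C * d powr s"
        using ps \<open>0 < C\<close> by (intro mult_mono) (auto simp: C_def)
      finally show ?thesis by (simp add: d_def)
    qed
  qed
  ultimately show ?thesis by blast
qed

end

section \<open>Bounds for the Hausdorff measure\<close>

text \<open>The parameters sent into a set of diameter r lie in an interval of length C r^s', so
  every cover of \<open>E\<close> induces a cover of [0, w) whose total length is at least w.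
  Measuring these intervals avoids any measurability question about \<open>h\<close>.\<close>

lemma hausdorff_outer_pos:
  fixes h :: "real \<Rightarrow> real"
  assumes w: "0 < w" and C: "0 < C" and s: "0 \<le> s" "s < s'"
    and mem: "\<And>t. 0 \<le> t \<Longrightarrow> t < w \<Longrightarrow> h t \<in> E"
    and hld: "\<And>t t'. 0 \<le> t \<Longrightarrow> t \<le> t' \<Longrightarrow> t' < w \<Longrightarrow> t' - t \<le> C * \<bar>h t - h t'\<bar> powr s'"
  shows "hausdorff_outer s E \<noteq> 0"
proof -
  have key: "ennreal (w / C) \<le> (\<Sum>i. hs_weight s (U i))"
    if U: "E \<subseteq> (\<Union>i. U i)" "\<And>i. bounded (U i)" "\<And>i. diameter (U i) \<le> 1" for U :: "nat \<Rightarrow> real set"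
  proof -
    define A where "A i = {t. 0 \<le> t \<and> t < w \<and> h t \<in> U i}" for i
    define J where "J i = (if A i = {} then {} else {Inf (A i)..Inf (A i) + C * diameter (U i) powr s'})" for i
    have bdd: "bdd_below (A i)" for i by (rule bdd_belowI[of _ 0]) (auto simp: A_def)
    have AJ: "A i \<subseteq> J i" for i
    proof
      fix t assume t: "t \<in> A i"
      have "t - C * diameter (U i) powr s' \<le> Inf (A i)"
      proof (rule cInf_greatest)
        fix t' assume t': "t' \<in> A i"
        show "t - C * diameter (U i) powr s' \<le> t'"
        proof (cases "t' \<le> t")
          case True
          have "\<bar>h t' - h t\<bar> \<le> diameter (U i)"
            using diameter_bounded_bound[OF U(2)[of i], of "h t'" "h t"] t t' by (auto simp: A_def dist_real_def)
          hence "C * \<bar>h t' - h t\<bar> powr s' \<le> C * diameter (U i) powr s'"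
            using C s by (intro mult_left_mono powr_mono2) auto
          moreover have "t - t' \<le> C * \<bar>h t' - h t\<bar> powr s'"
            using hld[of t' t] t t' True by (auto simp: A_def)
          ultimately show ?thesis by linarith
        next
          case False
          moreover have "0 \<le> C * diameter (U i) powr s'" using C by simp
          ultimately show ?thesis by linarith
        qed
      qed (use t in auto)
      moreover have "Inf (A i) \<le> t" using t bdd by (rule cInf_lower)
      ultimately show "t \<in> J i" using t by (auto simp: J_def)
    qed
    have Jw: "emeasure lborel (J i) \<le> ennreal C * hs_weight s (U i)" for i
    proof (cases "A i = {}")
      case True
      thus ?thesis by (simp add: J_def)
    next
      case False
      hence ne: "U i \<noteq> {}" by (auto simp: A_def)
      have d0: "0 \<le> diameter (U i)" by (rule diameter_ge_0[OF U(2)])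
      \<comment> \<open>Diameters at most 1 make the exponent s' the smaller weight; s = 0 is
        separate because \<open>hs_weight\<close> is then 1 even for a set of diameter 0.\<close>
      have "ennreal (diameter (U i) powr s') \<le> hs_weight s (U i)"
      proof (cases "s = 0")
        case True
        have "diameter (U i) powr s' \<le> 1 powr s'"
          using U(3) d0 s by (intro powr_mono2) auto
        thus ?thesis using True ne by (simp add: hs_weight_def ennreal_le_1)
      next
        case False
        have "diameter (U i) powr s' \<le> diameter (U i) powr s"
          using U(3)[of i] d0 s by (cases "diameter (U i) = 0") (auto intro!: powr_mono')
        thus ?thesis using False ne by (simp add: hs_weight_def ennreal_leI)
      qed
      hence "ennreal C * ennreal (diameter (U i) powr s') \<le> ennreal C * hs_weight s (U i)"
        by (rule mult_left_mono) simp
      thus ?thesis using False C by (simp add: J_def ennreal_mult'')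
    qed
    have "ennreal w = emeasure lborel {0..<w}" using w by simp
    also have "\<dots> \<le> emeasure lborel (\<Union>i. J i)"
    proof (rule emeasure_mono)
      show "{0..<w} \<subseteq> (\<Union>i. J i)"
      proof
        fix t assume t: "t \<in> {0..<w}"
        hence "h t \<in> (\<Union>i. U i)" using mem U(1) by auto
        then obtain i where "t \<in> A i" using t by (auto simp: A_def)
        thus "t \<in> (\<Union>i. J i)" using AJ by blast
      qed
    qed (auto simp: J_def)
    also have "\<dots> \<le> (\<Sum>i. emeasure lborel (J i))"
      by (rule emeasure_subadditive_countably) (auto simp: J_def)
    also have "\<dots> \<le> (\<Sum>i. ennreal C * hs_weight s (U i))"
      by (intro suminf_le Jw) auto
    also have "\<dots> = ennreal C * (\<Sum>i. hs_weight s (U i))" by simp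
    finally have "ennreal (1 / C) * ennreal w \<le> ennreal (1 / C) * (ennreal C * (\<Sum>i. hs_weight s (U i)))"
      by (rule mult_left_mono) simp
    thus ?thesis
      using C w by (simp add: mult.assoc[symmetric] ennreal_mult[symmetric] del: ennreal_mult'')
  qed
  have "ennreal (w / C) \<le> hausdorff_content_delta s 1 E"
    unfolding hausdorff_content_delta_def by (rule INF_greatest) (use key in auto)
  also have "\<dots> \<le> hausdorff_outer s E"
    unfolding hausdorff_outer_def by (rule SUP_upper) simp
  finally have "ennreal (w / C) \<le> hausdorff_outer s E" .
  moreover have "0 < ennreal (w / C)" using w C by simp
  ultimately show ?thesis by auto
qed

text \<open>Covering by N intervals of length 1/N costs N^(1-s), which tends to 0.\<close>

lemma hausdorff_outer_unit_interval:
  assumes E: "E \<subseteq> {0..<1}" and s: "1 < s"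
  shows "hausdorff_outer s E = 0"
proof -
  have "hausdorff_content_delta s \<delta> E \<le> ennreal (real (Suc n) powr (1 - s))"
    if \<delta>: "0 < \<delta>" and n: "1 / real (Suc n) \<le> \<delta>" for \<delta> n
  proof -
    define N where "N = Suc n"
    \<comment> \<open>Empty sets pad the finite cover to a sequence at no cost.\<close>
    define U where "U i = (if i < N then {real i / N .. (real i + 1) / N} else {})" for i
    have dU: "diameter (U i) = (if i < N then 1 / N else 0)" for i
      by (auto simp: U_def N_def add_divide_distrib diameter_closed_interval divide_right_mono)
    have "E \<subseteq> (\<Union>i. U i)"
    proof
      fix x assume "x \<in> E"
      hence x: "0 \<le> x" "x < 1" using E by auto
      define i where "i = nat \<lfloor>x * N\<rfloor>"
      have r: "real i = of_int \<lfloor>x * N\<rfloor>" using x by (simp add: i_def)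
      have 1: "real i \<le> x * N" "x * N < real i + 1" unfolding r by linarith+
      have "x * N < N" using x by (simp add: N_def)
      hence "i < N" using 1 by linarith
      hence "x \<in> U i" using 1 by (auto simp: U_def N_def field_simps)
      thus "x \<in> (\<Union>i. U i)" by blast
    qed
    moreover have "bounded (U i) \<and> diameter (U i) \<le> \<delta>" for i
      using n \<delta> by (auto simp: dU) (auto simp: U_def N_def)
    ultimately have "hausdorff_content_delta s \<delta> E \<le> (\<Sum>i. hs_weight s (U i))"
      unfolding hausdorff_content_delta_def by (intro INF_lower) auto
    also have "\<dots> = (\<Sum>i<N. hs_weight s (U i))"
      by (rule suminf_finite) (auto simp: U_def hs_weight_def)
    also have "\<dots> = (\<Sum>i<N. ennreal ((1 / N) powr s))"
    proof (rule sum.cong)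
      fix i assume "i \<in> {..<N}"
      thus "hs_weight s (U i) = ennreal ((1 / N) powr s)"
        using s by (auto simp: hs_weight_def dU) (auto simp: U_def N_def divide_right_mono)
    qed simp
    also have "\<dots> = ennreal (N * (1 / N) powr s)"
      by (simp add: ennreal_mult ennreal_of_nat_eq_real_of_nat)
    also have "N * (1 / N) powr s = N powr (1 - s)"
      by (simp add: N_def powr_diff powr_divide)
    finally show ?thesis by (simp add: N_def)
  qed
  moreover have "(\<lambda>n. ennreal (real (Suc n) powr (1 - s))) \<longlonglongrightarrow> 0"
  proof -
    have "(\<lambda>n. real (Suc n) powr (1 - s)) \<longlonglongrightarrow> 0"
      using s by (intro tendsto_neg_powr LIMSEQ_Suc[of "\<lambda>n. real n powr (1 - s)"] filterlim_real_sequentially) auto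
    thus ?thesis using tendsto_ennrealI by fastforce
  qed
  ultimately have "hausdorff_content_delta s \<delta> E \<le> 0" if "0 < \<delta>" for \<delta>
  proof -
    have "eventually (\<lambda>n. 1 / real (Suc n) < \<delta>) sequentially"
      using order_tendstoD(2)[OF LIMSEQ_Suc[OF lim_1_over_n] that] by simp
    hence "eventually (\<lambda>n. hausdorff_content_delta s \<delta> E \<le> ennreal (real (Suc n) powr (1 - s))) sequentially"
      using \<open>\<And>\<delta> n. 0 < \<delta> \<Longrightarrow> 1 / real (Suc n) \<le> \<delta> \<Longrightarrow> _\<close> that by (auto elim!: eventually_mono)
    thus ?thesis
      using \<open>(\<lambda>n. ennreal (real (Suc n) powr (1 - s))) \<longlonglongrightarrow> 0\<close> tendsto_lowerbound by fastforce
  qed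
  hence "hausdorff_outer s E \<le> 0" unfolding hausdorff_outer_def by (intro SUP_least) auto
  thus ?thesis by simp
qed

section \<open>Exponents different from 1\<close>

lemma dist_int_le: "dist_int t \<le> \<bar>t - of_int p\<bar>"
  unfolding dist_int_def by (rule round_diff_minimal)

lemma dist_int_triangle: "dist_int (s - t) \<le> dist_int s + dist_int t"
  using dist_int_le[of "s - t" "round s - round t"] by (simp add: dist_int_def)

text \<open>Since s exceeds the supremum defining \<open>irr_exp\<close>, the liminf for s is
  nonzero, hence positive. This handles all large j; the finitely many others have positive distance
  by irrationality, and c is a minimum.\<close>

lemma diophantine_lower_bound:
  assumes irr: "\<theta> \<notin> \<rat>" and ex: "irr_exp \<theta> = 1" and s: "1 < s"
  obtains c where "0 < c" "\<And>j::nat. 1 \<le> j \<Longrightarrow> c * real j powr (- s) \<le> dist_int (real j * \<theta>)"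
proof -
  define f where "f j = real j powr s * dist_int (real j * \<theta>)" for j
  define A where "A = {s. s > 0 \<and> Liminf sequentially (\<lambda>j::nat. ereal (real j powr s * dist_int (real j * \<theta>))) = 0}"
  have fpos: "0 < f j" if "1 \<le> j" for j
  proof -
    have "real j * \<theta> \<noteq> of_int (round (real j * \<theta>))"
    proof
      assume "real j * \<theta> = of_int (round (real j * \<theta>))"
      hence "\<theta> = of_int (round (real j * \<theta>)) / real j" using that by (simp add: field_simps)
      hence "\<theta> \<in> \<rat>" by (metis Rats_divide Rats_of_int Rats_of_nat)
      thus False using irr by simp
    qed
    thus ?thesis using that by (simp add: f_def dist_int_def)
  qed
  have "s \<notin> A"
  proof
    assume "s \<in> A"
    hence "ereal s \<le> Sup (ereal ` A)" by (intro Sup_upper) auto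
    thus False using ex s by (simp add: irr_exp_def A_def)
  qed
  hence ne: "Liminf sequentially (\<lambda>j. ereal (f j)) \<noteq> 0" using s by (auto simp: A_def f_def)
  have "0 \<le> Liminf sequentially (\<lambda>j. ereal (f j))"
    by (intro Liminf_bounded) (auto simp: f_def dist_int_def)
  hence "0 < Liminf sequentially (\<lambda>j. ereal (f j))" using ne by simp
  then obtain y where y: "0 < y" "y < Liminf sequentially (\<lambda>j. ereal (f j))"
    using dense by blast
  then obtain d where d: "y = ereal d" "0 < d" by (cases y) auto
  have "eventually (\<lambda>j. ereal d < ereal (f j)) sequentially"
    using less_LiminfD y d by blast
  then obtain N where N: "\<And>j. N \<le> j \<Longrightarrow> d < f j"
    by (auto simp: eventually_sequentially)
  define c where "c = Min (insert d (f ` {1..N}))"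
  have "0 < c" unfolding c_def using d fpos by (subst Min_gr_iff) auto
  moreover have "c * real j powr (- s) \<le> dist_int (real j * \<theta>)" if j: "1 \<le> j" for j
  proof -
    have "c \<le> f j"
    proof (cases "j \<le> N")
      case True
      thus ?thesis unfolding c_def using j by (intro Min_le) auto
    next
      case False
      hence "d \<le> f j" using N[of j] by simp
      moreover have "c \<le> d" unfolding c_def by (intro Min_le) auto
      ultimately show ?thesis by simp
    qed
    hence "c * real j powr (- s) \<le> f j * real j powr (- s)" by (intro mult_right_mono) auto
    also have "\<dots> = dist_int (real j * \<theta>)" using j by (simp add: f_def powr_minus field_simps)
    finally show ?thesis .
  qed
  ultimately show ?thesis using that by blast
qed

section \<open>Exponents below 1\<close>

lemma unif_approx_lt_1:
  assumes irr: "\<theta> \<notin> \<rat>" and ex: "irr_exp \<theta> = 1" and \<tau>: "0 < \<tau>" "\<tau> < 1"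
  shows "unif_approx \<tau> \<theta> = torus"
proof -
  \<comment> \<open>The midpoint of 1 and 1/\<tau>: the density 2/q will be of order Q^(-1/s), which
    must beat Q^(-\<tau>).\<close>
  define s where "s = (1 + 1 / \<tau>) / 2"
  have "1 < 1 / \<tau>" using \<tau> by simp
  hence s: "1 < s" "s < 1 / \<tau>" by (auto simp: s_def)
  hence s\<tau>: "\<tau> < 1 / s" using \<tau> by (simp add: field_simps)
  obtain c where c: "0 < c" "\<And>j::nat. 1 \<le> j \<Longrightarrow> c * real j powr (- s) \<le> dist_int (real j * \<theta>)"
    using diophantine_lower_bound[OF irr ex s(1)] by blast
  have "((\<lambda>Q. Q powr (\<tau> - 1 / s)) \<longlongrightarrow> 0) at_top"
    using s\<tau> by (intro tendsto_neg_powr filterlim_ident) auto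
  moreover have "0 < 1 / (2 * (c / 2) powr (- (1 / s)))" using c by simp
  ultimately have "eventually (\<lambda>Q. Q powr (\<tau> - 1 / s) < 1 / (2 * (c / 2) powr (- (1 / s)))) at_top"
    by (rule order_tendstoD)
  then obtain Q1 where Q1: "\<And>Q. Q1 \<le> Q \<Longrightarrow> Q powr (\<tau> - 1 / s) < 1 / (2 * (c / 2) powr (- (1 / s)))"
    by (auto simp: eventually_at_top_linorder)
  have "\<exists>n::nat. 1 \<le> n \<and> real n \<le> Q \<and> dist_int (real n * \<theta> - y) < Q powr (- \<tau>)"
    if Q: "max 2 Q1 \<le> Q" for Q y
  proof -
    define N where "N = nat \<lfloor>Q\<rfloor>"
    have N: "real N \<le> Q" "Q < real N + 1" "2 \<le> N"
      using Q by (auto simp: N_def le_nat_floor) 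
    obtain h k where hk: "coprime h k" "0 < k" "k \<le> int N" "\<bar>of_int k * \<theta> - of_int h\<bar> < 1 / real N"
      using Dirichlet_approx_coprime[of N \<theta>] N by auto
    define q where "q = nat k"
    have q: "1 \<le> q" "q \<le> N" "int q = k" "real q = of_int k" using hk by (auto simp: q_def)
    have ql: "(c / 2 * Q) powr (1 / s) \<le> real q"
    proof -
      have "c * real q powr (- s) \<le> 1 / real N"
        using c(2)[OF q(1)] dist_int_le[of "real q * \<theta>" h] hk q by simp
      hence "c * real N \<le> real q powr s" using q N by (simp add: powr_minus field_simps)
      \<comment> \<open>Here Q < N + 1 \<le> 2N.\<close>
      moreover have "c / 2 * Q \<le> c * real N" using c N by simp
      ultimately have "c / 2 * Q \<le> real q powr s" by linarith
      hence "(c / 2 * Q) powr (1 / s) \<le> (real q powr s) powr (1 / s)"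
        using c Q s by (intro powr_mono2) auto
      thus ?thesis using q s by (simp add: powr_powr)
    qed
    \<comment> \<open>The fraction m/q is within 1/(2q) of y. Bezout gives an n with n h congruent
      to m modulo q, so that n h/q equals m/q modulo 1.\<close>
    define m where "m = round (y * real q)"
    obtain u0 v0 where "u0 * h + v0 * k = 1"
      using bezout_int[of h k] hk by auto
    hence u: "h * (m * u0) - m = k * (- (m * v0))" by algebra
    define r where "r = (m * u0) mod k"
    have r: "0 \<le> r" "r < k" using hk by (auto simp: r_def)
    \<comment> \<open>The residue 0 is represented by q, because n must be at least 1.\<close>
    define n where "n = (if r = 0 then q else nat r)"
    have n: "1 \<le> n" "n \<le> q" using r q(1,3) by (auto simp: n_def nat_le_iff)
    have "int n mod k = r" using r q(3) by (auto simp: n_def)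
    hence "int n mod k = (m * u0) mod k" by (simp only: r_def)
    hence "k dvd int n - m * u0" by (simp only: mod_eq_dvd_iff)
    hence "k dvd h * (int n - m * u0) + (h * (m * u0) - m)" unfolding u by simp
    hence "k dvd h * int n - m" by (simp add: algebra_simps)
    then obtain z where z: "h * int n - m = k * z" by blast
    have "\<bar>real n * \<theta> - y - of_int z\<bar> * real q \<le> \<bar>real n * (of_int k * \<theta> - of_int h)\<bar> + \<bar>of_int m - y * real q\<bar>"
    proof -
      have "of_int h * real n - of_int m = of_int k * of_int z"
        using arg_cong[OF z, of real_of_int] by simp
      hence "(real n * \<theta> - y - of_int z) * real q = real n * (of_int k * \<theta> - of_int h) + (of_int m - y * real q)"
        using q by (simp add: algebra_simps)
      hence "\<bar>real n * \<theta> - y - of_int z\<bar> * real q = \<bar>real n * (of_int k * \<theta> - of_int h) + (of_int m - y * real q)\<bar>"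
        by (metis abs_mult abs_of_nat)
      thus ?thesis by linarith
    qed
    also have "\<dots> \<le> 1 + 1 / 2"
    proof (intro add_mono)
      have "\<bar>real n * (of_int k * \<theta> - of_int h)\<bar> = real n * \<bar>of_int k * \<theta> - of_int h\<bar>" by (simp add: abs_mult)
      also have "\<dots> \<le> real N * (1 / real N)" using n q hk N by (intro mult_mono) auto
      finally show "\<bar>real n * (of_int k * \<theta> - of_int h)\<bar> \<le> 1" using N by simp
      show "\<bar>of_int m - y * real q\<bar> \<le> 1 / 2" unfolding m_def by (rule of_int_round_abs_le)
    qed
    finally have "\<bar>real n * \<theta> - y - of_int z\<bar> \<le> (1 + 1 / 2) / real q"
      using q by (simp add: pos_le_divide_eq)
    also have "\<dots> \<le> 2 / real q" by (intro divide_right_mono) auto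
    finally have "dist_int (real n * \<theta> - y) \<le> 2 / real q"
      using dist_int_le[of "real n * \<theta> - y" z] by linarith
    also have "\<dots> \<le> 2 / (c / 2 * Q) powr (1 / s)"
    proof (rule divide_left_mono)
      show "0 < real q * (c / 2 * Q) powr (1 / s)" using q c Q by (intro mult_pos_pos) auto
    qed (use ql in auto)
    also have "\<dots> = 2 / ((c / 2) powr (1 / s) * Q powr (1 / s))"
      using c Q by (subst powr_mult) auto
    also have "\<dots> = 2 * (c / 2) powr (- (1 / s)) * Q powr (- (1 / s))"
      by (simp only: powr_minus divide_inverse[of 2] inverse_mult_distrib mult.assoc)
    also have "\<dots> = (2 * (c / 2) powr (- (1 / s)) * Q powr (\<tau> - 1 / s)) * Q powr (- \<tau>)"
      using Q by (simp add: powr_add[symmetric])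
    also have "\<dots> < 1 * Q powr (- \<tau>)"
    proof (rule mult_strict_right_mono)
      show "2 * (c / 2) powr (- (1 / s)) * Q powr (\<tau> - 1 / s) < 1"
        using Q1[of Q] Q c by (simp add: field_simps)
    qed (use Q in simp)
    finally show ?thesis using n q N by (intro exI[of _ n]) auto
  qed
  thus ?thesis unfolding unif_approx_def by blast
qed

section \<open>Exponents above 1\<close>

lemma dist_int_eq_0_imp_frac:
  assumes "dist_int (x - y) = 0" "y \<in> torus"
  shows "y = frac x"
proof -
  have "x - y = of_int (round (x - y))" using assms by (simp add: dist_int_def)
  hence "x - y \<in> \<int>" by (metis Ints_of_int)
  hence "frac x = y" using assms(2) by (simp add: frac_unique_iff torus_def)
  thus ?thesis by simp
qed

lemma unif_approx_gt_1:
  assumes irr: "\<theta> \<notin> \<rat>" and ex: "irr_exp \<theta> = 1" and \<tau>: "1 < \<tau>"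
  shows "unif_approx \<tau> \<theta> = {frac (real i * \<theta>) | i::nat. i \<ge> 1}"
proof (intro equalityI subsetI)
  fix y assume "y \<in> {frac (real i * \<theta>) | i::nat. i \<ge> 1}"
  then obtain i :: nat where i: "i \<ge> 1" "y = frac (real i * \<theta>)" by auto
  have "dist_int (real i * \<theta> - y) \<le> 0"
    using dist_int_le[of "real i * \<theta> - y" "\<lfloor>real i * \<theta>\<rfloor>"] i by (simp add: frac_def)
  have "dist_int (real i * \<theta> - y) < Q powr (- \<tau>)" if "real i \<le> Q" for Q
  proof -
    have "0 < Q" using that i by linarith
    hence "0 < Q powr (- \<tau>)" by simp
    thus ?thesis using \<open>dist_int (real i * \<theta> - y) \<le> 0\<close> by linarith
  qed
  moreover have "y \<in> torus" using i by (simp add: torus_def frac_ge_0 frac_lt_1)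
  ultimately show "y \<in> unif_approx \<tau> \<theta>" unfolding unif_approx_def using i by blast
next
  fix y assume y: "y \<in> unif_approx \<tau> \<theta>"
  hence yt: "y \<in> torus" by (simp add: unif_approx_def)
  from y obtain Q0 where Q0: "\<And>Q. Q \<ge> Q0 \<Longrightarrow>
      \<exists>n::nat. 1 \<le> n \<and> real n \<le> Q \<and> dist_int (real n * \<theta> - y) < Q powr (- \<tau>)"
    by (auto simp: unif_approx_def)
  define N0 where "N0 = nat \<lceil>max Q0 1\<rceil>"
  have N0: "Q0 \<le> real N" "1 \<le> N" if "N0 \<le> N" for N
    using that by (auto simp: N0_def nat_le_iff ceiling_le_iff)
  have "\<forall>N. \<exists>n::nat. N0 \<le> N \<longrightarrow> 1 \<le> n \<and> n \<le> N \<and> dist_int (real n * \<theta> - y) < real N powr (- \<tau>)"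
    using Q0 N0 by (metis of_nat_le_iff)
  then obtain n :: "nat \<Rightarrow> nat" where n: "\<And>N. N0 \<le> N \<Longrightarrow> 1 \<le> n N \<and> n N \<le> N \<and> dist_int (real (n N) * \<theta> - y) < real N powr (- \<tau>)"
    by metis
  \<comment> \<open>Any exponent strictly between 1 and \<tau> makes N^(-\<tau>) negligible against
    the lower bound c (2N)^(-s).\<close>
  define s where "s = (1 + \<tau>) / 2"
  have s: "1 < s" "s < \<tau>" using \<tau> by (auto simp: s_def)
  obtain c where c: "0 < c" "\<And>j::nat. 1 \<le> j \<Longrightarrow> c * real j powr (- s) \<le> dist_int (real j * \<theta>)"
    using diophantine_lower_bound[OF irr ex s(1)] by blast
  have "(\<lambda>N. real N powr (s - \<tau>)) \<longlonglongrightarrow> 0"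
    using s by (intro tendsto_neg_powr filterlim_real_sequentially) auto
  moreover have "0 < c * 2 powr (- s) / 2" using c by simp
  ultimately have "eventually (\<lambda>N. real N powr (s - \<tau>) < c * 2 powr (- s) / 2) sequentially"
    by (rule order_tendstoD)
  then obtain N1 where N1: "\<And>N. N1 \<le> N \<Longrightarrow> real N powr (s - \<tau>) < c * 2 powr (- s) / 2"
    by (auto simp: eventually_sequentially)
  \<comment> \<open>The range up to 2N also contains the index chosen for N + 1; the bound is the
    triangle inequality applied to (a - b) theta.\<close>
  have separated: "c * 2 powr (- s) * real N powr (- s) \<le> dist_int (real a * \<theta> - y) + dist_int (real b * \<theta> - y)"
    if "b < a" "a \<le> 2 * N" "1 \<le> N" for a b N :: nat
  proof -
    have "c * 2 powr (- s) * real N powr (- s) = c * (2 * real N) powr (- s)"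
      by (simp add: powr_mult)
    also have "\<dots> \<le> c * real (a - b) powr (- s)"
      using that c s by (intro mult_left_mono powr_mono2') auto
    also have "\<dots> \<le> dist_int (real (a - b) * \<theta>)" using that by (intro c(2)) auto
    also have "real (a - b) * \<theta> = (real a * \<theta> - y) - (real b * \<theta> - y)"
      using that by (simp add: algebra_simps of_nat_diff)
    finally show ?thesis using dist_int_triangle[of "real a * \<theta> - y" "real b * \<theta> - y"] by linarith
  qed
  have step: "n (Suc N) = n N" if N: "max N0 N1 \<le> N" for N
  proof (rule ccontr)
    assume ne: "n (Suc N) \<noteq> n N"
    have N': "1 \<le> N" using N0 N by simp
    have d1: "dist_int (real (n N) * \<theta> - y) < real N powr (- \<tau>)" "n N \<le> N" using n[of N] N by auto
    have "dist_int (real (n (Suc N)) * \<theta> - y) < real (Suc N) powr (- \<tau>)" "n (Suc N) \<le> Suc N"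
      using n[of "Suc N"] N by auto
    moreover have "real (Suc N) powr (- \<tau>) \<le> real N powr (- \<tau>)"
      using N' \<tau> by (intro powr_mono2') auto
    ultimately have d2: "dist_int (real (n (Suc N)) * \<theta> - y) < real N powr (- \<tau>)" "n (Suc N) \<le> Suc N"
      by auto
    have "c * 2 powr (- s) * real N powr (- s) < 2 * real N powr (- \<tau>)"
      using separated[of "n N" "n (Suc N)" N] separated[of "n (Suc N)" "n N" N] ne d1 d2 N'
      by (cases "n N < n (Suc N)") auto
    also have "real N powr (- \<tau>) = real N powr (s - \<tau>) * real N powr (- s)"
      by (simp add: powr_add[symmetric])
    finally have "c * 2 powr (- s) * real N powr (- s) < 2 * real N powr (s - \<tau>) * real N powr (- s)"
      by simp
    hence "c * 2 powr (- s) < 2 * real N powr (s - \<tau>)" by (simp add: mult_less_cancel_right)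
    thus False using N1[of N] N by simp
  qed
  define M where "M = max N0 N1"
  have const: "n (M + i) = n M" for i
  proof (induction i)
    case (Suc i)
    have "n (Suc (M + i)) = n (M + i)" by (rule step) (simp add: M_def)
    thus ?case using Suc by simp
  qed simp
  \<comment> \<open>One fixed index now satisfies the bounds for all large N, so its distance to y
    is 0.\<close>
  have "(\<lambda>i. real (i + M) powr (- \<tau>)) \<longlonglongrightarrow> 0"
    using \<tau> by (intro LIMSEQ_ignore_initial_segment[of "\<lambda>i. real i powr (- \<tau>)"] tendsto_neg_powr filterlim_real_sequentially) auto
  moreover have "dist_int (real (n M) * \<theta> - y) \<le> real (i + M) powr (- \<tau>)" for i
    using n[of "M + i"] const[of i] by (simp add: M_def add.commute less_imp_le)
  ultimately have "dist_int (real (n M) * \<theta> - y) \<le> 0"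
    by (intro LIMSEQ_le_const) auto
  hence "dist_int (real (n M) * \<theta> - y) = 0" by (simp add: dist_int_def)
  hence "y = frac (real (n M) * \<theta>)" using yt by (rule dist_int_eq_0_imp_frac)
  moreover have "1 \<le> n M" using n[of M] by (simp add: M_def)
  ultimately show "y \<in> {frac (real i * \<theta>) | i::nat. i \<ge> 1}" by blast
qed

section \<open>Ostrowski cells\<close>

text \<open>With e = m - i, the bounds n \<le> q and r \<le> d reduce the claim to (i + 2) e + i + 1
  \<le> m^2 \<le> a and the identity \<open>det\<close>. The integer inequality fails only for i =
  1, m = 2, where it would read 5 \<le> 4. In the application the first factor bounds Q and the
  second the distance to y.\<close>

lemma window_inequality:
  fixes q q' n d r a :: real and i m :: nat
  assumes pos: "0 < r" "r \<le> d" "0 \<le> q'" "q' \<le> q"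
    and det: "(a * q + q') * d + q * r = 1"
    and im: "1 \<le> i" "i < m"
    and n: "if long then n \<le> q' \<and> real m ^ 2 \<le> a else n \<le> q \<and> real m ^ 2 \<le> a - 1"
  shows "(n + (real i + 1) * q) * ((real m - real i) * d + r) \<le> 1"
proof (cases "3 \<le> m")
  case True
  define e where "e = m - i"
  have e: "1 \<le> e" "m = i + e" using im by (auto simp: e_def)
  have nat_ineq: "(i + 2) * e + i + 1 \<le> m ^ 2"
  proof (cases "e = 1")
    case True
    hence "2 \<le> i" using \<open>3 \<le> m\<close> e by simp
    hence "2 * 2 \<le> i * i" by (intro mult_le_mono)
    thus ?thesis using True e \<open>2 \<le> i\<close> by (simp add: power2_eq_square)
  next
    case False
    hence "2 * e \<le> e * e" "i \<le> i * i" "1 \<le> i * e" using e im by (auto simp: Suc_le_eq)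
    moreover have "m ^ 2 = i * i + 2 * (i * e) + e * e" "(i + 2) * e = i * e + 2 * e"
      using e by (simp_all add: power2_eq_square algebra_simps)
    ultimately show ?thesis by linarith
  qed
  have "real ((i + 2) * e + i + 1) \<le> real (m ^ 2)" using nat_ineq by (rule of_nat_mono)
  hence ineq: "(real i + 2) * real e + real i + 1 \<le> a" using n by (auto simp: algebra_simps split: if_splits)
  have ne: "n \<le> q" using n pos by (auto split: if_splits)
  have "(real i + 1) * r \<le> (real i + 1) * d" using pos by (intro mult_left_mono) auto
  hence "(real i + 2) * (real e * d + r) \<le> ((real i + 2) * real e + real i + 1) * d + r"
    by (simp add: algebra_simps)
  also have "\<dots> \<le> a * d + r"
    using ineq pos by (intro add_mono mult_right_mono) auto
  finally have key: "(real i + 2) * (real e * d + r) \<le> a * d + r" .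
  have "(n + (real i + 1) * q) * (real e * d + r) \<le> ((real i + 2) * q) * (real e * d + r)"
    using ne pos by (intro mult_right_mono) (auto simp: algebra_simps)
  also have "\<dots> = q * ((real i + 2) * (real e * d + r))" by simp
  also have "\<dots> \<le> q * (a * d + r)" using key pos by (intro mult_left_mono) auto
  also have "\<dots> \<le> 1"
  proof -
    have "0 \<le> q' * d" using pos by simp
    thus ?thesis using det by (simp add: algebra_simps)
  qed
  finally show ?thesis using e by simp
next
  case False
  \<comment> \<open>The missing unit comes from n \<le> q' in the long case and from a \<ge> 5 in
    the other.\<close>
  hence im: "i = 1" "m = 2" using im by auto
  have qr: "q * r \<le> q * d" "q' * r \<le> q * d" using pos by (auto intro!: mult_mono)
  show ?thesis
  proof (cases long)
    case True
    hence "4 * (q * d) \<le> a * (q * d)" "n \<le> q'"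
      using n im pos by (auto intro!: mult_right_mono)
    moreover from this have "(n + 2 * q) * (d + r) \<le> (q' + 2 * q) * (d + r)"
      using pos by (intro mult_right_mono) auto
    ultimately show ?thesis using det im qr by (simp add: algebra_simps)
  next
    case False
    hence "5 * (q * d) \<le> a * (q * d)" "n \<le> q"
      using n im pos by (auto intro!: mult_right_mono)
    moreover from this have "(n + 2 * q) * (d + r) \<le> (q + 2 * q) * (d + r)"
      using pos by (intro mult_right_mono) auto
    moreover have "0 \<le> q' * d" using pos by simp
    ultimately show ?thesis using det im qr by (simp add: algebra_simps)
  qed
qed

section \<open>Continued fraction remainders and denominators\<close>

text \<open>
  Signs and indices: \<open>den (Suc k)\<close> is the classical denominator q_k and \<open>err (Suc k)\<close> the distance of
  q_k theta to the corresponding numerator, so \<open>den 0 = 0\<close> and \<open>err 0 = 1\<close> play the role of index -1.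
  The differences q_k theta - p_k alternate in sign, starting positive.
\<close>
locale irrational_rotation =
  fixes \<theta> :: real
  assumes pos: "0 < \<theta>" and less_1: "\<theta> < 1" and irrational: "\<theta> \<notin> \<rat>"
begin

fun err :: "nat \<Rightarrow> real" where
  "err 0 = 1"
| "err (Suc 0) = \<theta>"
| "err (Suc (Suc k)) = err k - of_int \<lfloor>err k / err (Suc k)\<rfloor> * err (Suc k)"

text \<open>In the classical numbering this is the partial quotient a_(k+1); a_0 = 0 does not
  occur.\<close>

definition quot :: "nat \<Rightarrow> nat" where
  "quot k = nat \<lfloor>err k / err (Suc k)\<rfloor>"

fun den :: "nat \<Rightarrow> nat" where
  "den 0 = 0"
| "den (Suc 0) = 1"
| "den (Suc (Suc k)) = quot k * den (Suc k) + den k"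

lemma not_int_multiple:
  assumes "1 \<le> n"
  shows "real n * \<theta> \<noteq> of_int p"
proof
  assume "real n * \<theta> = of_int p"
  hence "\<theta> = of_int p / real n" using assms by (simp add: field_simps)
  hence "\<theta> \<in> \<rat>" by (metis Rats_divide Rats_of_int Rats_of_nat)
  thus False using irrational by simp
qed

text \<open>A single induction carries all the facts: positivity of the next remainder rests on the
  formula with numerators, since a zero remainder would make a positive multiple of theta an
  integer.\<close>

lemma convergents:
  "0 < err (Suc k) \<and> err (Suc k) < err k \<and> 1 \<le> den (Suc k) \<and> den k \<le> den (Suc k) \<and>
   (\<exists>p::int. real (den k) * \<theta> - p = - ((-1) ^ k) * err k) \<and>
   (\<exists>p::int. real (den (Suc k)) * \<theta> - p = (-1) ^ k * err (Suc k))"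
proof (induction k)
  case 0
  have "real (den 0) * \<theta> - of_int 1 = - ((-1) ^ 0) * err 0"
    "real (den (Suc 0)) * \<theta> - of_int 0 = (-1) ^ 0 * err (Suc 0)" by simp_all
  thus ?case using pos less_1 by (auto simp del: of_int_1 of_int_0)
next
  case (Suc k)
  define a where "a = \<lfloor>err k / err (Suc k)\<rfloor>"
  from Suc obtain p p' :: int where p: "real (den k) * \<theta> - p = - ((-1) ^ k) * err k"
    "real (den (Suc k)) * \<theta> - p' = (-1) ^ k * err (Suc k)" by blast
  have "1 < err k / err (Suc k)" using Suc by simp
  hence a: "1 \<le> a" "quot k = nat a" by (auto simp: a_def quot_def)
  hence aq: "real (quot k) = of_int a" by simp
  have e: "err (Suc (Suc k)) = err k - of_int a * err (Suc k)" by (simp add: a_def)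
  have "of_int a \<le> err k / err (Suc k)" "err k / err (Suc k) < of_int a + 1"
    unfolding a_def by linarith+
  hence b: "0 \<le> err (Suc (Suc k))" "err (Suc (Suc k)) < err (Suc k)"
    using Suc unfolding e by (auto simp: field_simps)
  have "1 \<le> quot k" using a by simp
  hence "1 * den (Suc k) \<le> quot k * den (Suc k)" by (rule mult_le_mono1)
  hence d: "1 \<le> den (Suc (Suc k))" "den (Suc k) \<le> den (Suc (Suc k))"
    using Suc unfolding den.simps(3) by linarith+
  have r: "real (den (Suc (Suc k))) * \<theta> - of_int (a * p' + p) = (-1) ^ Suc k * err (Suc (Suc k))"
  proof -
    have "real (den (Suc (Suc k))) * \<theta> - of_int (a * p' + p) =
        of_int a * (real (den (Suc k)) * \<theta> - p') + (real (den k) * \<theta> - p)"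
      using aq by (simp add: algebra_simps)
    thus ?thesis unfolding p e by (simp add: algebra_simps)
  qed
  have "err (Suc (Suc k)) \<noteq> 0"
    using r not_int_multiple[OF d(1), of "a * p' + p"] by auto
  hence "0 < err (Suc (Suc k))" using b by simp
  moreover have "\<exists>p::int. real (den (Suc k)) * \<theta> - p = - ((-1) ^ Suc k) * err (Suc k)"
    using p(2) by (intro exI[of _ p']) simp
  ultimately show ?case using b d r by blast
qed

lemma err_pos: "0 < err k"
  using convergents[of k] by linarith

lemma err_less: "err (Suc k) < err k"
  using convergents by blast

lemma den_mono: "den k \<le> den (Suc k)"
  using convergents by blast

lemma quot_ge_1: "1 \<le> quot k"
proof -
  have "1 < err k / err (Suc k)" using err_less[of k] err_pos[of "Suc k"] by simp
  thus ?thesis by (simp add: quot_def le_nat_iff)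
qed

lemma err_rec: "err k = real (quot k) * err (Suc k) + err (Suc (Suc k))"
proof -
  have "0 \<le> err k / err (Suc k)" using err_pos by (simp add: less_imp_le)
  thus ?thesis by (simp add: quot_def)
qed

declare err.simps(3) [simp del]

text \<open>The determinant identity of consecutive convergents, written with remainders in place of
  numerators.\<close>

lemma den_err: "real (den (Suc k)) * err k + real (den k) * err (Suc k) = 1"
proof (induction k)
  case (Suc k)
  have "real (den (Suc (Suc k))) * err (Suc k) + real (den (Suc k)) * err (Suc (Suc k)) =
     real (den (Suc k)) * (real (quot k) * err (Suc k) + err (Suc (Suc k))) + real (den k) * err (Suc k)"
    by (simp add: algebra_simps)
  thus ?case using Suc err_rec[of k] by simp
qed simp

text \<open>For k = 1 there is equality when \<open>quot 0\<close> is 1.\<close>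

lemma den_Suc_less: "2 \<le> k \<Longrightarrow> den k < den (Suc k)"
proof -
  assume "2 \<le> k"
  then obtain j where k: "k = Suc (Suc j)" using add_2_eq_Suc le_Suc_ex by blast
  have "den (Suc (Suc j)) \<le> quot (Suc j) * den (Suc (Suc j))" using quot_ge_1[of "Suc j"] by simp
  moreover have "1 \<le> den (Suc j)" using convergents by blast
  ultimately show ?thesis unfolding k den.simps(3)[of "Suc j"] by linarith
qed

lemma den_ge: "k \<le> den (Suc k)"
proof (induction k)
  case (Suc k)
  show ?case
  proof (cases "k = 0")
    case True
    thus ?thesis using convergents[of 1] by simp
  next
    case False
    thus ?thesis using Suc den_Suc_less[of "Suc k"] by linarith
  qed
qed simp

lemma den_err_le: "real (den (Suc k)) * err k \<le> 1"
proof -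
  have "0 \<le> real (den k) * err (Suc k)" using err_pos[of "Suc k"] by simp
  thus ?thesis using den_err[of k] by linarith
qed

lemma err_tendsto_0: "err \<longlonglongrightarrow> 0"
proof (rule tendsto_sandwich[where f = "\<lambda>_. 0" and h = "\<lambda>k. 1 / real k"])
  show "eventually (\<lambda>k. err k \<le> 1 / real k) sequentially"
  proof (rule eventually_sequentiallyI[of 1])
    fix k :: nat assume k: "1 \<le> k"
    have "real k * err k \<le> real (den (Suc k)) * err k"
      using den_ge[of k] err_pos[of k] by (intro mult_right_mono) auto
    hence "real k * err k \<le> 1" using den_err_le[of k] by linarith
    thus "err k \<le> 1 / real k" using k by (simp add: field_simps)
  qed
  show "(\<lambda>k. 1 / real k) \<longlonglongrightarrow> 0" by (rule lim_1_over_n)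
qed (auto intro!: always_eventually less_imp_le[OF err_pos])

lemma dist_int_den: "dist_int (real (den (Suc k)) * \<theta>) \<le> err (Suc k)"
proof -
  obtain p :: int where "real (den (Suc k)) * \<theta> - p = (-1) ^ k * err (Suc k)"
    using convergents by blast
  hence "\<bar>real (den (Suc k)) * \<theta> - p\<bar> = err (Suc k)"
    using err_pos[of "Suc k"] by (simp add: abs_mult power_abs)
  thus ?thesis using dist_int_le[of "real (den (Suc k)) * \<theta>" p] by simp
qed

section \<open>Ostrowski cells as an interval tree\<close>

text \<open>
  A cell of level k is a triple (long, n, x) where x is n theta modulo 1 and n < q_k is the Ostrowski
  partial sum; long says that the previous digit was 0, which is the case where the next digit may
  reach the full partial quotient. In the orientation given by the sign (-1)^k, the cell is the
  interval [x - \<open>err (Suc k)\<close>, x + \<open>right k long\<close>].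
\<close>
definition top :: "nat \<Rightarrow> bool \<Rightarrow> nat" where
  "top k long = (if long then quot k else quot k - 1)"

definition right :: "nat \<Rightarrow> bool \<Rightarrow> real" where
  "right k long = real (top k long) * err (Suc k) + err (Suc (Suc k))"

lemma right_eq: "right k long = (if long then err k else err k - err (Suc k))"
  using err_rec[of k] quot_ge_1[of k] by (auto simp: right_def top_def of_nat_diff algebra_simps)

definition cell_lo :: "nat \<Rightarrow> bool \<times> nat \<times> real \<Rightarrow> real" where
  "cell_lo k = (\<lambda>(long, n, x). if even k then x - err (Suc k) else x - right k long)"

definition cell_hi :: "nat \<Rightarrow> bool \<times> nat \<times> real \<Rightarrow> real" where
  "cell_hi k = (\<lambda>(long, n, x). if even k then x + right k long else x + err (Suc k))"

text \<open>This encodes the restriction m^2 \<le> \<open>top k long\<close> on the digits m,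
  counting the digit 0.\<close>

definition digits :: "nat \<Rightarrow> bool \<times> nat \<times> real \<Rightarrow> nat" where
  "digits k = (\<lambda>(long, n, x). Suc (floor_sqrt (top k long)))"

definition refine :: "nat \<Rightarrow> bool \<times> nat \<times> real \<Rightarrow> nat \<Rightarrow> bool \<times> nat \<times> real" where
  "refine k = (\<lambda>(long, n, x) m. (m = 0, n + m * den (Suc k), x + (-1) ^ k * real m * err (Suc k)))"

text \<open>Reversing the digits at odd levels enumerates the children from left to right, as
  \<open>interval_tree\<close> demands.\<close>

definition child :: "nat \<Rightarrow> bool \<times> nat \<times> real \<Rightarrow> nat \<Rightarrow> bool \<times> nat \<times> real" where
  "child k c i = refine k c (if even k then i else digits k c - Suc i)"

lemma cell_length: "cell_hi k (long, n, x) - cell_lo k (long, n, x) = (if long then err k + err (Suc k) else err k)"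
  by (auto simp: cell_hi_def cell_lo_def right_eq)

text \<open>Put d = \<open>err (Suc k)\<close> and r = \<open>err (Suc (Suc k))\<close>. Relative to
  x, in the orientation of level k, digit 0 occupies [-d, r] and a digit m \<ge> 1 occupies
  [(m-1)d + r, md + r]. Consecutive cells abut, and all digits up to \<open>top\<close> together
  would fill the parent.\<close>

lemma refine_bounds:
  "even k \<Longrightarrow> cell_hi (Suc k) (refine k (long, n, x) m) = x + real m * err (Suc k) + err (Suc (Suc k))"
  "even k \<Longrightarrow> cell_lo (Suc k) (refine k (long, n, x) m) =
     x + real m * err (Suc k) - err (Suc k) + (if m = 0 then 0 else err (Suc (Suc k)))"
  "odd k \<Longrightarrow> cell_lo (Suc k) (refine k (long, n, x) m) = x - real m * err (Suc k) - err (Suc (Suc k))"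
  "odd k \<Longrightarrow> cell_hi (Suc k) (refine k (long, n, x) m) =
     x - real m * err (Suc k) + err (Suc k) - (if m = 0 then 0 else err (Suc (Suc k)))"
  by (auto simp: refine_def cell_hi_def cell_lo_def right_eq)

lemma refine_nested:
  assumes "m < digits k (long, n, x)"
  shows "cell_lo k (long, n, x) \<le> cell_lo (Suc k) (refine k (long, n, x) m)"
    "cell_hi (Suc k) (refine k (long, n, x) m) \<le> cell_hi k (long, n, x)"
proof -
  have "m \<le> floor_sqrt (top k long)" using assms by (simp add: digits_def)
  also have "\<dots> \<le> top k long" by (rule floor_sqrt_le)
  finally have "real m * err (Suc k) \<le> real (top k long) * err (Suc k)"
    using err_pos[of "Suc k"] by (intro mult_right_mono) auto
  hence r: "real m * err (Suc k) + err (Suc (Suc k)) \<le> right k long" by (simp add: right_def)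
  have e: "0 < err (Suc (Suc k))" "0 < err (Suc k)" by (rule err_pos)+
  have "0 \<le> real m * err (Suc k)" using e by simp
  hence me: "- err (Suc (Suc k)) \<le> real m * err (Suc k)" using e by linarith
  show "cell_lo k (long, n, x) \<le> cell_lo (Suc k) (refine k (long, n, x) m)"
    using r e me by (cases "even k") (auto simp: refine_bounds cell_lo_def[of k])
  show "cell_hi (Suc k) (refine k (long, n, x) m) \<le> cell_hi k (long, n, x)"
    using r e me by (cases "even k") (auto simp: refine_bounds cell_hi_def[of k])
qed

lemma refine_order:
  assumes "i < j"
  shows "even k \<Longrightarrow> cell_hi (Suc k) (refine k (long, n, x) i) \<le> cell_lo (Suc k) (refine k (long, n, x) j)"
    "odd k \<Longrightarrow> cell_hi (Suc k) (refine k (long, n, x) j) \<le> cell_lo (Suc k) (refine k (long, n, x) i)"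
proof -
  have "(real i + 1) * err (Suc k) \<le> real j * err (Suc k)"
    using assms err_pos[of "Suc k"] by (intro mult_right_mono) auto
  thus "even k \<Longrightarrow> cell_hi (Suc k) (refine k (long, n, x) i) \<le> cell_lo (Suc k) (refine k (long, n, x) j)"
    "odd k \<Longrightarrow> cell_hi (Suc k) (refine k (long, n, x) j) \<le> cell_lo (Suc k) (refine k (long, n, x) i)"
    using assms by (auto simp: refine_bounds algebra_simps)
qed

text \<open>For B the largest digit, \<open>top\<close> is at most B^2 + 2B, so the parent has
  length at most (B + 1)^2 d + r. The children have lengths d + r, once, and d, B times; squaring
  the sum of roots gives at least that much. Here the square-root range of digits matches the
  exponent 1/2.\<close>

lemma sqrt_length_le:
  "sqrt (cell_hi k c - cell_lo k c) \<le>
    (\<Sum>i<digits k c. sqrt (cell_hi (Suc k) (child k c i) - cell_lo (Suc k) (child k c i)))"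
proof -
  obtain long n x where c: "c = (long, n, x)" by (cases c) auto
  define d where "d = err (Suc k)"
  define r where "r = err (Suc (Suc k))"
  define B where "B = floor_sqrt (top k long)"
  define f where "f m = sqrt (if m = 0 then d + r else d)" for m :: nat
  have dr: "0 < d" "0 < r" by (simp_all add: d_def r_def err_pos)
  have f: "sqrt (cell_hi (Suc k) (refine k c m) - cell_lo (Suc k) (refine k c m)) = f m" for m
    by (auto simp: c refine_def cell_length f_def d_def r_def)
  have D: "digits k c = Suc B" by (simp add: c digits_def B_def)
  have "(\<Sum>i<digits k c. sqrt (cell_hi (Suc k) (child k c i) - cell_lo (Suc k) (child k c i))) = (\<Sum>i<Suc B. f i)"
  proof (cases "even k")
    case True
    thus ?thesis unfolding child_def f D by simp
  next
    case False
    thus ?thesis unfolding child_def f D using sum.nat_diff_reindex[of f "Suc B"] by simp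
  qed
  also have "\<dots> = sqrt (d + r) + real B * sqrt d"
    unfolding sum.lessThan_Suc_shift by (simp add: f_def)
  finally have S: "(\<Sum>i<digits k c. sqrt (cell_hi (Suc k) (child k c i) - cell_lo (Suc k) (child k c i))) =
    sqrt (d + r) + real B * sqrt d" .
  have "top k long < (Suc B) ^ 2" unfolding B_def by (rule Suc_floor_sqrt_power2_gt)
  hence "Suc (top k long) \<le> (Suc B) ^ 2" by simp
  hence "real (Suc (top k long)) \<le> real ((Suc B) ^ 2)" by (rule of_nat_mono)
  hence tB: "real (top k long) \<le> real B ^ 2 + 2 * real B" by (simp add: power2_eq_square algebra_simps)
  have "sqrt (cell_hi k c - cell_lo k c) \<le> sqrt (d + r) + real B * sqrt d"
  proof (rule real_le_lsqrt)
    have "cell_hi k c - cell_lo k c = (real (top k long) + 1) * d + r"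
      by (auto simp: c cell_hi_def cell_lo_def right_def d_def r_def algebra_simps)
    also have "\<dots> \<le> (real B ^ 2 + 2 * real B + 1) * d + r"
      using tB dr by (intro add_right_mono mult_right_mono) auto
    also have "\<dots> = sqrt (d + r) ^ 2 + (real B * sqrt d) ^ 2 + 2 * real B * (sqrt d * sqrt d)"
      using dr by (simp add: power_mult_distrib algebra_simps)
    also have "\<dots> \<le> sqrt (d + r) ^ 2 + (real B * sqrt d) ^ 2 + 2 * real B * (sqrt (d + r) * sqrt d)"
      using dr by (intro add_left_mono mult_left_mono mult_right_mono) auto
    also have "\<dots> = (sqrt (d + r) + real B * sqrt d) ^ 2"
      by (simp add: power2_eq_square algebra_simps)
    finally show "cell_hi k c - cell_lo k c \<le> (sqrt (d + r) + real B * sqrt d) ^ 2" .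
  qed (use dr in auto)
  thus ?thesis unfolding S .
qed

lemma interval_tree_cells:
  "interval_tree (\<lambda>j. cell_lo (K + j)) (\<lambda>j. cell_hi (K + j)) (\<lambda>j. digits (K + j))
    (\<lambda>j. child (K + j)) (\<lambda>j. err (K + j))"
proof
  fix j :: nat and c :: "bool \<times> nat \<times> real"
  obtain long n x where c: "c = (long, n, x)" by (cases c) auto
  show "0 < err (K + j)" by (rule err_pos)
  show "err (K + j) \<le> cell_hi (K + j) c - cell_lo (K + j) c"
    "cell_hi (K + j) c - cell_lo (K + j) c \<le> 2 * err (K + j)"
    using err_pos[of "K + j"] err_pos[of "Suc (K + j)"] err_less[of "K + j"] by (auto simp: c cell_length)
  show "sqrt (cell_hi (K + j) c - cell_lo (K + j) c) \<le>
    (\<Sum>i<digits (K + j) c. sqrt (cell_hi (K + Suc j) (child (K + j) c i) - cell_lo (K + Suc j) (child (K + j) c i)))"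
    using sqrt_length_le[of "K + j" c] by simp
  fix i
  {
    assume "i < digits (K + j) c"
    hence "(if even (K + j) then i else digits (K + j) c - Suc i) < digits (K + j) c" by auto
    thus "cell_lo (K + j) c \<le> cell_lo (K + Suc j) (child (K + j) c i)"
      "cell_hi (K + Suc j) (child (K + j) c i) \<le> cell_hi (K + j) c"
      using refine_nested[of _ "K + j" long n x] by (auto simp: c child_def)
  }
  fix i' assume "i < i'" "i' < digits (K + j) c"
  thus "cell_hi (K + Suc j) (child (K + j) c i) \<le> cell_lo (K + Suc j) (child (K + j) c i')"
    using refine_order[of i i' "K + j" long n x]
      refine_order[of "digits (K + j) c - Suc i'" "digits (K + j) c - Suc i" "K + j" long n x]
    by (auto simp: c child_def)
next
  show "(\<lambda>j. err (K + j)) \<longlonglongrightarrow> 0"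
    using LIMSEQ_ignore_initial_segment[OF err_tendsto_0, of K] by (simp add: add.commute)
qed

section \<open>Uniform approximation of the limit points\<close>

lemma dist_int_shift:
  fixes p :: int
  assumes "real j * \<theta> - p = z"
  shows "dist_int (real j * \<theta> - y) \<le> \<bar>z - y\<bar>"
  using dist_int_le[of "real j * \<theta> - y" p] assms by (simp add: algebra_simps)

text \<open>
  Let t be the oriented position of y relative to x. As long as Q < n + q_k, one of the two points
  of index below q_k that enclose y is close enough, because half the gap between them is below 1/Q
  for every y. Afterwards the points n + i q_k approach y, and the bound on the digit enters only
  through \<open>window_inequality\<close>.
\<close>
lemma approximable_between_denominators:
  fixes p :: int
  assumes n: "1 \<le> n" "n < den (Suc k)" "n \<noteq> den k" "long \<longleftrightarrow> n < den k" "real n * \<theta> - p = x"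
    and m: "m < digits k (long, n, x)"
    and y: "cell_lo k (long, n, x) \<le> y" "y \<le> cell_hi k (long, n, x)"
      "cell_lo (Suc k) (refine k (long, n, x) m) \<le> y" "y \<le> cell_hi (Suc k) (refine k (long, n, x) m)"
    and Q: "real (den (Suc k)) \<le> Q" "Q < real (den (Suc (Suc k)))"
  shows "\<exists>j::nat. 1 \<le> j \<and> real j \<le> Q \<and> dist_int (real j * \<theta> - y) < 1 / Q"
proof -
  define sg :: real where "sg = (-1) ^ k"
  define q q' a where "q = den (Suc k)" and "q' = den k" and "a = quot k"
  define d' d r where "d' = err k" and "d = err (Suc k)" and "r = err (Suc (Suc k))"
  define t where "t = sg * (y - x)"
  note defs = q_def q'_def a_def d'_def d_def r_def
  have sg: "sg * sg = 1" "\<bar>sg\<bar> = 1" by (auto simp: sg_def power_abs simp flip: power_mult_distrib)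
  have dpos: "0 < r" "r < d" "d < d'" "0 < d" using err_pos err_less by (auto simp: defs)
  have qpos: "q' \<le> q" "1 \<le> q" using convergents[of k] by (auto simp: defs)
  have det: "real q * d' + real q' * d = 1" using den_err[of k] by (simp add: defs)
  have d'_eq: "d' = real a * d + r" using err_rec[of k] by (simp add: defs)
  have det': "(real a * real q + real q') * d + real q * r = 1"
    using det unfolding d'_eq by (simp add: algebra_simps)
  have Q': "real q \<le> Q" "Q < real a * real q + real q'" using Q by (auto simp: defs)
  have Qpos: "0 < Q" using Q' qpos by linarith
  have yt: "y = x + sg * t" using sg by (simp add: t_def mult.assoc[symmetric])
  have t1: "- d \<le> t" "t \<le> right k long"
    using y(1,2) by (cases "even k"; auto simp: t_def sg_def cell_lo_def cell_hi_def defs)+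
  have t2: "t \<le> real m * d + r" "0 < m \<Longrightarrow> (real m - 1) * d + r \<le> t"
    using y(3,4) by (cases "even k"; auto simp: t_def sg_def refine_bounds defs algebra_simps)+
  obtain pq pq' :: int where pq: "real q * \<theta> - pq = sg * d" "real q' * \<theta> - pq' = - sg * d'"
    using convergents[of k] by (auto simp: defs sg_def)
  have near: "dist_int (real (n + i * q) * \<theta> - y) \<le> \<bar>t - real i * d\<bar>" for i
  proof -
    have "real (n + i * q) * \<theta> - of_int (p + int i * pq) = (real n * \<theta> - p) + real i * (real q * \<theta> - pq)"
      by (simp add: algebra_simps)
    also have "\<dots> = x + real i * (sg * d)" unfolding n pq ..
    finally have "dist_int (real (n + i * q) * \<theta> - y) \<le> \<bar>x + real i * (sg * d) - y\<bar>"
      by (rule dist_int_shift)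
    also have "x + real i * (sg * d) - y = - sg * (t - real i * d)" unfolding yt by (simp add: algebra_simps)
    also have "\<bar>\<dots>\<bar> = \<bar>t - real i * d\<bar>" using sg by (simp add: abs_mult)
    finally show ?thesis .
  qed
  \<comment> \<open>The neighbour of n beyond y has index n + q - q' if n < q', and n - q'
    otherwise; \<open>gap\<close> is its distance from the point of index n.\<close>
  define gap where "gap = (if long then d' + d else d')"
  obtain e :: nat where e: "1 \<le> e" "e < q" "dist_int (real e * \<theta> - y) \<le> \<bar>gap - t\<bar>"
  proof (cases long)
    case True
    define e where "e = n + q - q'"
    have e1: "1 \<le> e" "e < q" "real e = real n + real q - real q'"
      using True n qpos by (auto simp: e_def defs of_nat_diff)
    have "real e * \<theta> - of_int (p + pq - pq') = (real n * \<theta> - p) + (real q * \<theta> - pq) - (real q' * \<theta> - pq')"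
      unfolding e1 by (simp add: algebra_simps)
    also have "\<dots> = x + sg * d + sg * d'" unfolding n pq by simp
    finally have "dist_int (real e * \<theta> - y) \<le> \<bar>x + sg * d + sg * d' - y\<bar>" by (rule dist_int_shift)
    also have "x + sg * d + sg * d' - y = sg * (gap - t)"
      using True unfolding yt gap_def by (simp add: algebra_simps)
    also have "\<bar>\<dots>\<bar> = \<bar>gap - t\<bar>" using sg by (simp add: abs_mult)
    finally show ?thesis using that e1 by blast
  next
    case False
    define e where "e = n - q'"
    have e1: "1 \<le> e" "e < q" "real e = real n - real q'"
      using False n by (auto simp: e_def defs of_nat_diff)
    have "real e * \<theta> - of_int (p - pq') = (real n * \<theta> - p) - (real q' * \<theta> - pq')"
      unfolding e1 by (simp add: algebra_simps)
    also have "\<dots> = x + sg * d'" unfolding n pq by simp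
    finally have "dist_int (real e * \<theta> - y) \<le> \<bar>x + sg * d' - y\<bar>" by (rule dist_int_shift)
    also have "x + sg * d' - y = sg * (gap - t)"
      using False unfolding yt gap_def by (simp add: algebra_simps)
    also have "\<bar>\<dots>\<bar> = \<bar>gap - t\<bar>" using sg by (simp add: abs_mult)
    finally show ?thesis using that e1 by blast
  qed
  have t_gap: "t \<le> gap" using t1 right_eq[of k long] dpos by (auto simp: gap_def defs split: if_splits)
  have witness: ?thesis if "1 \<le> j" "real j \<le> Q" "dist_int (real j * \<theta> - y) \<le> E" "Q * E < 1" for j E
  proof -
    have "E < 1 / Q" using that Qpos by (simp add: field_simps)
    thus ?thesis using that by (intro exI[of _ j]) auto
  qed
  have Qd: "Q * d < 1"
  proof -
    have "Q * d < (real a * real q + real q') * d" using Q' dpos by simp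
    moreover have "0 < real q * r" using qpos dpos by simp
    ultimately show ?thesis using det' by linarith
  qed
  have nQ: "real n \<le> Q" using n Q' by (simp add: defs)
  \<comment> \<open>In the first and third cases a point within d of y is available, and Q d < 1
    suffices. The second uses n or its neighbour, the fourth an intermediate point.\<close>
  consider "t < 0" | "0 \<le> t" "Q < real n + real q" | "0 \<le> t" "real (n + m * q) \<le> Q"
    | "0 \<le> t" "real n + real q \<le> Q" "Q < real (n + m * q)" by linarith
  thus ?thesis
  proof cases
    case 1
    hence "dist_int (real n * \<theta> - y) \<le> d" using near[of 0] t1 by simp
    thus ?thesis using n nQ Qd by (intro witness[of n d]) auto
  next
    case 2
    have half: "Q * (gap / 2) < 1"
    proof (cases long)
      case True
      have "Q < real q + real q'" using 2 True n by (simp add: defs)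
      hence "Q * gap < (real q + real q') * (d' + d)"
        using True dpos unfolding gap_def by (auto intro: mult_strict_right_mono)
      \<comment> \<open>With \<open>det\<close> this yields q d + q' d' \<le> 1, hence (q + q')(d' +
        d) \<le> 2.\<close>
      moreover have "0 \<le> (real q - real q') * (d' - d)" using qpos dpos by simp
      ultimately show ?thesis using det by (simp add: algebra_simps)
    next
      case False
      have "Q * gap < (2 * real q) * d'"
        using 2 False n dpos unfolding gap_def by (auto simp: defs)
      moreover have "0 \<le> real q' * d" using dpos by simp
      ultimately show ?thesis using det by (simp add: algebra_simps)
    qed
    show ?thesis
    proof (cases "t \<le> gap / 2")
      case True
      thus ?thesis using near[of 0] 2 half n nQ by (intro witness[of n "gap / 2"]) auto
    next
      case False
      thus ?thesis using e t_gap half Q' by (intro witness[of e "gap / 2"]) auto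
    qed
  next
    case 3
    have "\<bar>t - real m * d\<bar> \<le> d"
      using t2 dpos 3 by (cases "m = 0") (auto simp: algebra_simps abs_le_iff)
    hence "dist_int (real (n + m * q) * \<theta> - y) \<le> d" using near[of m] by linarith
    thus ?thesis using 3 n Qd by (intro witness[of "n + m * q" d]) auto
  next
    case 4
    \<comment> \<open>The last point n + i q with index at most Q; since 1 \<le> i < m, it does not
      pass y, and y is at most (m - i) d + r ahead.\<close>
    define i where "i = (LEAST i. Q < real (n + Suc i * q))"
    have m1: "1 \<le> m" using 4 nQ by (cases m) auto
    have "Q < real (n + Suc (m - 1) * q)" using 4 m1 by simp
    hence i: "Q < real (n + Suc i * q)" "i \<le> m - 1"
      unfolding i_def by (rule LeastI, intro Least_le)
    have "i \<noteq> 0" using i 4 by (intro notI) simp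
    hence i1: "1 \<le> i" by simp
    hence "\<not> Q < real (n + Suc (i - 1) * q)"
      unfolding i_def by (intro not_less_Least) simp
    hence lower: "real (n + i * q) \<le> Q" using i1 by simp
    have im: "i < m" using i m1 by simp
    define E where "E = (real m - real i) * d + r"
    have Epos: "0 < E" using im dpos by (simp add: E_def add_nonneg_pos)
    have "real i * d \<le> (real m - 1) * d" using im dpos by (intro mult_right_mono) auto
    hence "\<bar>t - real i * d\<bar> \<le> E" using t2 m1 dpos by (simp add: E_def algebra_simps)
    hence dE: "dist_int (real (n + i * q) * \<theta> - y) \<le> E" using near[of i] by linarith
    have "Q < real n + (real i + 1) * real q" using i by (simp add: algebra_simps)
    hence "Q * E < (real n + (real i + 1) * real q) * E" using Epos by (rule mult_strict_right_mono)
    also have "\<dots> \<le> 1" unfolding E_def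
    proof (rule window_inequality[where long = long])
      have "m \<le> floor_sqrt (top k long)" using m by (simp add: digits_def)
      hence "m ^ 2 \<le> top k long" by (simp add: floor_sqrt_power2_le le_floor_sqrt_iff)
      hence "real m ^ 2 \<le> real (top k long)" by (metis of_nat_le_iff of_nat_power)
      also have "real (top k long) = (if long then real a else real a - 1)"
        using quot_ge_1[of k] by (auto simp: top_def a_def of_nat_diff)
      finally have "real m ^ 2 \<le> (if long then real a else real a - 1)" .
      thus "if long then real n \<le> real q' \<and> (real m)\<^sup>2 \<le> real a else real n \<le> real q \<and> (real m)\<^sup>2 \<le> real a - 1"
        using n by (auto simp: q_def q'_def)
    qed (use dpos qpos det' i1 im in auto)
    finally show ?thesis using dE lower n by (intro witness[of "n + i * q" E]) auto
  qed
qed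

text \<open>Every Q from \<open>den (Suc K)\<close> on lies between two consecutive denominators,
  and the cell of that level together with its next digit yields the witness. The invariant
  \<open>inv\<close> supplies the arithmetic hypotheses on the partial sum n.\<close>

lemma limit_points_approximable:
  assumes K: "2 \<le> K" "2 \<le> den K"
    and c: "c 0 = (True, 1, \<theta>)" "\<And>j. \<exists>i<digits (K + j) (c j). c (Suc j) = child (K + j) (c j) i"
    and y: "\<And>j. cell_lo (K + j) (c j) \<le> y \<and> y \<le> cell_hi (K + j) (c j)" "y \<in> torus"
  shows "y \<in> unif_approx 1 \<theta>"
proof -
  have step: "\<exists>m<digits (K + j) (c j). c (Suc j) = refine (K + j) (c j) m" for j
    using c(2)[of j] unfolding child_def by (cases "even (K + j)") (auto intro: exI[of _ "digits (K + j) (c j) - Suc _"])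
  have inv: "\<exists>long n x (p::int). c j = (long, n, x) \<and> 1 \<le> n \<and> n < den (Suc (K + j)) \<and> n \<noteq> den (K + j) \<and>
      (long \<longleftrightarrow> n < den (K + j)) \<and> real n * \<theta> - p = x" for j
  proof (induction j)
    case 0
    \<comment> \<open>The root is the point theta with partial sum 1; \<open>2 \<le> den K\<close>
      makes 1 < \<open>den K\<close>, which justifies its flag \<open>True\<close>.\<close>
    have "real 1 * \<theta> - of_int 0 = \<theta>" by simp
    moreover have "1 < den (Suc K)" using K den_mono[of K] by linarith
    ultimately show ?case using c(1) K by (intro exI[of _ True] exI[of _ 1] exI[of _ \<theta>] exI[of _ 0]) auto
  next
    case (Suc j)
    define k where "k = K + j"
    from Suc obtain long n x and p :: int where n: "c j = (long, n, x)" "1 \<le> n" "n < den (Suc k)"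
      "n \<noteq> den k" "long \<longleftrightarrow> n < den k" "real n * \<theta> - p = x" unfolding k_def by blast
    obtain m where m: "m < digits k (long, n, x)" "c (Suc j) = refine k (long, n, x) m"
      using step[of j] n(1) unfolding k_def by auto
    obtain pq :: int where pq: "real (den (Suc k)) * \<theta> - pq = (-1) ^ k * err (Suc k)"
      using convergents by blast
    have "m \<le> floor_sqrt (top k long)" using m by (simp add: digits_def)
    also have "\<dots> \<le> top k long" by (rule floor_sqrt_le)
    finally have mt: "m \<le> top k long" .
    \<comment> \<open>The Ostrowski rule at work: a full digit is paid for by n <
      \<open>den k\<close>; otherwise one multiple of \<open>den (Suc k)\<close> is left for
      n.\<close>
    have bound: "n + m * den (Suc k) < den (Suc (Suc k))"
    proof (cases long)
      case True
      hence "m * den (Suc k) \<le> quot k * den (Suc k)" using mt by (simp add: top_def)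
      thus ?thesis using True n(5) unfolding den.simps(3) by linarith
    next
      case False
      hence "(m + 1) * den (Suc k) \<le> quot k * den (Suc k)"
        using mt quot_ge_1[of k] by (intro mult_right_mono) (auto simp: top_def)
      thus ?thesis using n by simp
    qed
    have "n + m * den (Suc k) \<noteq> den (Suc k)" "m = 0 \<longleftrightarrow> n + m * den (Suc k) < den (Suc k)"
      using n by (cases m; simp)+
    moreover have "real (n + m * den (Suc k)) * \<theta> - of_int (p + int m * pq) = x + (-1) ^ k * real m * err (Suc k)"
    proof -
      have "real (n + m * den (Suc k)) * \<theta> - of_int (p + int m * pq) =
        (real n * \<theta> - p) + real m * (real (den (Suc k)) * \<theta> - pq)" by (simp add: algebra_simps)
      thus ?thesis unfolding n pq by simp
    qed
    moreover have "c (Suc j) = (m = 0, n + m * den (Suc k), x + (-1) ^ k * real m * err (Suc k))"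
      using m(2) by (simp add: refine_def)
    moreover have "1 \<le> n + m * den (Suc k)" using n by simp
    ultimately show ?case using bound unfolding k_def add_Suc_right by blast
  qed
  have "\<exists>n::nat. 1 \<le> n \<and> real n \<le> Q \<and> dist_int (real n * \<theta> - y) < Q powr (- 1)"
    if Q: "real (den (Suc K)) \<le> Q" for Q
  proof -
    define j where "j = (LEAST j. Q < real (den (Suc (Suc (K + j)))))"
    obtain M :: nat where "Q < real M" using reals_Archimedean2 by blast
    hence "Q < real (den (Suc (Suc (K + M))))" using den_ge[of "Suc (K + M)"] by linarith
    hence j: "Q < real (den (Suc (Suc (K + j))))" unfolding j_def by (rule LeastI)
    have lower: "real (den (Suc (K + j))) \<le> Q"
    proof (cases j)
      case 0
      thus ?thesis using Q by simp
    next
      case (Suc i)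
      hence "i < j" by simp
      hence "\<not> Q < real (den (Suc (Suc (K + i))))" unfolding j_def by (rule not_less_Least)
      thus ?thesis using Suc by simp
    qed
    obtain long n x and p :: int where n: "c j = (long, n, x)" "1 \<le> n" "n < den (Suc (K + j))"
      "n \<noteq> den (K + j)" "long \<longleftrightarrow> n < den (K + j)" "real n * \<theta> - p = x" using inv by blast
    obtain m where m: "m < digits (K + j) (long, n, x)" "c (Suc j) = refine (K + j) (long, n, x) m"
      using step[of j] n(1) by auto
    have "\<exists>j::nat. 1 \<le> j \<and> real j \<le> Q \<and> dist_int (real j * \<theta> - y) < 1 / Q"
      using approximable_between_denominators[OF n(2-) m(1), of y Q] y(1)[of j] y(1)[of "Suc j"] n(1) m(2) lower j by simp
    moreover have "0 < Q" using lower n by linarith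
    ultimately show ?thesis by (simp add: powr_minus_divide)
  qed
  thus ?thesis using y(2) unfolding unif_approx_def mem_Collect_eq by blast
qed

section \<open>Lower bound for the dimension at exponent 1\<close>

lemma hausdorff_outer_unif_approx_1:
  assumes ex: "irr_exp \<theta> = 1" and s: "0 \<le> s" "s < 1 / 2"
  shows "hausdorff_outer s (unif_approx 1 \<theta>) \<noteq> 0"
proof -
  define s' where "s' = (s + 1 / 2) / 2"
  have s': "s < s'" "0 < s'" "s' < 1 / 2" using s by (auto simp: s'_def)
  have "0 < min \<theta> (1 - \<theta>)" using pos less_1 by simp
  hence "eventually (\<lambda>k. err k < min \<theta> (1 - \<theta>)) sequentially"
    by (rule order_tendstoD(2)[OF err_tendsto_0])
  then obtain K0 where K0: "\<And>k. K0 \<le> k \<Longrightarrow> err k < min \<theta> (1 - \<theta>)"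
    by (auto simp: eventually_sequentially)
  \<comment> \<open>The shift by 3 gives \<open>den K\<close> at least 2, while the small remainder
    keeps the root cell around theta inside the torus.\<close>
  define K where "K = K0 + 3"
  have K: "2 \<le> K" "2 \<le> den K" "err K < \<theta>" "err K < 1 - \<theta>"
    using K0[of K] den_ge[of "K0 + 2"] by (auto simp: K_def eval_nat_numeral simp del: den.simps)
  define root where "root = (True, 1::nat, \<theta>)"
  interpret T: interval_tree "\<lambda>j. cell_lo (K + j)" "\<lambda>j. cell_hi (K + j)" "\<lambda>j. digits (K + j)"
    "\<lambda>j. child (K + j)" root "\<lambda>j. err (K + j)"
    by (rule interval_tree_cells)
  \<comment> \<open>Chosen so that \<open>err (Suc k)\<close> \<ge> c \<open>err k\<close>^\<sigma>,
    raised to the power s', becomes the square-root comparison required by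
    \<open>hoelder\<close>.\<close>
  define \<sigma> where "\<sigma> = 1 / (2 * s')"
  have \<sigma>: "1 < \<sigma>" "\<sigma> * s' = 1 / 2" using s' by (auto simp: \<sigma>_def field_simps)
  obtain c where c: "0 < c" "\<And>j::nat. 1 \<le> j \<Longrightarrow> c * real j powr (- \<sigma>) \<le> dist_int (real j * \<theta>)"
    using diophantine_lower_bound[OF irrational ex \<sigma>(1)] by blast
  have growth: "sqrt (err k) \<le> c powr (- s') * err (Suc k) powr s'" for k
  proof -
    have dp: "1 \<le> den (Suc k)" using convergents by blast
    have ep: "0 < err k" by (rule err_pos)
    have "real (den (Suc k)) \<le> 1 / err k" using den_err_le[of k] ep by (simp add: field_simps)
    hence "(1 / err k) powr (- \<sigma>) \<le> real (den (Suc k)) powr (- \<sigma>)"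
      using dp \<sigma> by (intro powr_mono2') auto
    hence "c * err k powr \<sigma> \<le> c * real (den (Suc k)) powr (- \<sigma>)"
      using c ep by (simp add: powr_minus powr_divide)
    also have "\<dots> \<le> err (Suc k)" using c(2)[OF dp] dist_int_den[of k] by linarith
    finally have "(c * err k powr \<sigma>) powr s' \<le> err (Suc k) powr s'"
      using c ep s' by (intro powr_mono2) auto
    hence "c powr s' * sqrt (err k) \<le> err (Suc k) powr s'"
      using c ep \<sigma> by (simp add: powr_mult powr_powr powr_half_sqrt)
    hence "c powr (- s') * (c powr s' * sqrt (err k)) \<le> c powr (- s') * err (Suc k) powr s'"
      by (intro mult_left_mono) auto
    thus ?thesis using c by (simp add: mult.assoc[symmetric] powr_add[symmetric])
  qed
  obtain C where C: "C > 0" "\<And>t t'. 0 \<le> t \<Longrightarrow> t \<le> t' \<Longrightarrow> t' < T.width \<Longrightarrow>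
      t' - t \<le> C * \<bar>T.point t - T.point t'\<bar> powr s'"
    using T.hoelder[OF s'(2), of "c powr (- s')"] growth by (metis add_Suc_right)
  show ?thesis
  proof (rule hausdorff_outer_pos[OF T.width_pos C(1) s(1) s'(1) _ C(2)])
    fix t assume t: "0 \<le> t" "t < T.width"
    have mem: "cell_lo (K + j) (T.cell t j) \<le> T.point t \<and> T.point t \<le> cell_hi (K + j) (T.cell t j)" for j
      by (rule T.point_mem[OF t])
    have "cell_lo K root \<le> T.point t" "T.point t \<le> cell_hi K root"
      using mem[of 0] by (auto simp: T.cell_0)
    hence "\<bar>T.point t - \<theta>\<bar> \<le> err K"
      using err_less[of K] by (auto simp: root_def cell_lo_def cell_hi_def right_eq split: if_splits)
    hence "T.point t \<in> torus" using K by (auto simp: torus_def)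
    thus "T.point t \<in> unif_approx 1 \<theta>"
      using limit_points_approximable[OF K(1,2), of "T.cell t"] T.cell_0 T.cell_Suc[OF t] mem
      by (simp add: root_def)
  qed auto
qed

end

theorem theorem2:
  fixes \<theta> :: real
  assumes "0 < \<theta>" and "\<theta> < 1" and "\<theta> \<notin> \<rat>"
    and "irr_exp \<theta> = 1"
  shows "(\<forall>\<tau>. 0 < \<tau> \<and> \<tau> < 1 \<longrightarrow> unif_approx \<tau> \<theta> = torus)
       \<and> (\<forall>\<tau>. \<tau> > 1 \<longrightarrow> unif_approx \<tau> \<theta> = {frac (real i * \<theta>) | i::nat. i \<ge> 1})
       \<and> 1/2 \<le> hausdorff_dim (unif_approx 1 \<theta>)
       \<and> hausdorff_dim (unif_approx 1 \<theta>) \<le> 1"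
proof -
  define S where "S = {s. s \<ge> 0 \<and> hausdorff_outer s (unif_approx 1 \<theta>) = 0}"
  interpret irrational_rotation \<theta> by unfold_locales fact+
  have "unif_approx 1 \<theta> \<subseteq> {0..<1}" by (auto simp: unif_approx_def torus_def)
  hence S_gt: "s \<in> S" if "1 < s" for s
    using hausdorff_outer_unit_interval that by (auto simp: S_def)
  have lower: "1 / 2 \<le> s" if "s \<in> S" for s
    using that hausdorff_outer_unif_approx_1[OF assms(4), of s] by (force simp: S_def)
  \<comment> \<open>The real infimum is meaningful only for a nonempty set, so a member is needed
    before bounding it below.\<close>
  have "2 \<in> S" by (rule S_gt) simp
  hence "1 / 2 \<le> Inf S" using lower by (intro cInf_greatest) auto
  moreover have "Inf S \<le> 1"
  proof (rule dense_ge)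
    fix s :: real assume "1 < s"
    thus "Inf S \<le> s" using S_gt lower by (intro cInf_lower bdd_belowI[of _ "1 / 2"]) auto
  qed
  moreover have "hausdorff_dim (unif_approx 1 \<theta>) = Inf S" by (simp add: hausdorff_dim_def S_def)
  ultimately show ?thesis
    using unif_approx_lt_1[OF assms(3,4)] unif_approx_gt_1[OF assms(3,4)] by auto
qed

end
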